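(* Let $(A,B)$ be stabilizable, $Q\succ0$, $R\succ0$. For every $\varepsilon>0$ there exists a value $\nu>0$ (not depending on the dataset) such that the following holds. Let $(U_0,X_0,X_1)$ be a dataset generated from an experiment on the system $x(k+1)=Ax(k)+Bu(k)+d(k)$, and let $\operatorname{rank}W_0=n+m$. If $\mathrm{SNR}>\nu$, then the indirect certainty-equivalence problem (I) defined in the context is feasible, and its optimal solution $(\overline P,\overline K)$ is such that $\overline K$ is stabilizing (i.e. $A+B\overline K$ is Schur) with sub-optimality gap $$\frac{\|\mathscr T(\overline K)\|_2^2-\|\mathscr T(K_\star)\|_2^2}{\|\mathscr T(K_\star)\|_2^2}\le\varepsilon .$$
   Context: System: $x(k+1)=Ax(k)+Bu(k)+d(k)$ with real matrices $A\in\mathbb R^{n\times n}$, $B\in\mathbb R^{n\times m}$, $(A,B)$ stabilizable, and an arbitrary disturbance $d(k)\in\mathbb R^n$ (no statistical assumptions). A square matrix is Schur if all its eigenvalues lie in the open unit disc. $Q\in\mathbb R^{n\times n}$, $R\in\mathbb R^{m\times m}$ are symmetric positive definite; $\succ,\succeq,\preceq$ refer to the semidefinite order. For $K\in\mathbb R^{m\times n}$ with $A+BK$ Schur, $\mathscr T(K)$ is the transfer function from $d$ to $z=\begin{bmatrix}Q^{1/2}x\\ R^{1/2}u\end{bmatrix}$ of the closed loop with $u=Kx$, and its squared $\mathcal H_2$-norm is $\|\mathscr T(K)\|_2^2=\operatorname{trace}(QP+K^\top RKP)$, where $P$ is the unique solution of $(A+BK)P(A+BK)^\top-P+I=0$.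 $K_\star$ is the (unique) gain minimizing $\|\mathscr T(K)\|_2$ over all $K$ with $A+BK$ Schur. Data: from a $T$-long trajectory of the system, set $U_0=[u(0)\ \cdots\ u(T-1)]\in\mathbb R^{m\times T}$, $X_0=[x(0)\ \cdots\ x(T-1)]\in\mathbb R^{n\times T}$, $X_1=[x(1)\ \cdots\ x(T)]\in\mathbb R^{n\times T}$, $D_0=[d(0)\ \cdots\ d(T-1)]\in\mathbb R^{n\times T}$, $W_0=\begin{bmatrix}U_0\\ X_0\end{bmatrix}\in\mathbb R^{(n+m)\times T}$, so that $X_1-D_0=[B\ \ A]W_0$. The signal-to-noise ratio is $$\mathrm{SNR}:=\frac{\sigma_{\min}(W_0)}{\sigma_{\max}(D_0)},$$ where $\sigma_{\min}$ and $\sigma_{\max}$ are the minimum and maximum singular values (for $\operatorname{rank}W_0=n+m$, $\sigma_{\min}(W_0)$ is the $(n+m)$-th singular value, and $\mathrm{SNR}=1/(\|D_0\|_2\|W_0^\dagger\|_2)$ with $W_0^\dagger=W_0^\top(W_0W_0^\top)^{-1}$ and $\|\cdot\|_2$ the induced 2-norm; $\mathrm{SNR}=+\infty$ if $D_0=0$). Problem (I): minimize $\operatorname{trace}(QP+K^\top RKP)$ over symmetric $P\succeq I$ and $K\in\mathbb R^{m\times n}$, subject to $(\hat A+\hat BK)P(\hat A+\hat BK)^\top-P+I\preceq0$ and $[\hat B\ \ \hat A]=\arg\min_{B,A}\|X_1-[B\ \ A]W_0\|_F$ ($\|\cdot\|_F$ the Frobenius norm). $(\overline P,\overline K)$ denotes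 any optimal solution of (I). *)

theory Defs
  imports "HOL-Analysis.Analysis"
begin

section \<open>Matrices\<close>

definition Schur :: "real^'n^'n \<Rightarrow> bool" where
  "Schur M \<longleftrightarrow>
    (\<forall>(z::complex) v. v \<noteq> 0 \<and> map_matrix complex_of_real M *v v = z *s v
      \<longrightarrow> cmod z < 1)"

definition pos_def :: "real^'n^'n \<Rightarrow> bool" where
  "pos_def M \<longleftrightarrow> transpose M = M \<and> (\<forall>v. v \<noteq> 0 \<longrightarrow> 0 < v \<bullet> (M *v v))"

definition pos_semidef :: "real^'n^'n \<Rightarrow> bool" where
  "pos_semidef M \<longleftrightarrow> transpose M = M \<and> (\<forall>v. 0 \<le> v \<bullet> (M *v v))"

definition loewner_le :: "real^'n^'n \<Rightarrow> real^'n^'n \<Rightarrow> bool" where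
  "loewner_le M N \<longleftrightarrow> pos_semidef (N - M)"

definition stabilizable :: "real^'n^'n \<Rightarrow> real^'m^'n \<Rightarrow> bool" where
  "stabilizable A B \<longleftrightarrow> (\<exists>K :: real^'n^'m. Schur (A + B ** K))"


section \<open>The \<open>H\<^sub>2\<close> norm and the optimal gain\<close>

text \<open>The left-hand side of the Lyapunov equation, respectively of the Lyapunov inequality.\<close>

definition lyapunov ::
  "real^'n^'n \<Rightarrow> real^'m^'n \<Rightarrow> real^'n^'m \<Rightarrow> real^'n^'n \<Rightarrow> real^'n^'n" where
  "lyapunov A B K P = (A + B ** K) ** P ** transpose (A + B ** K) - P + mat 1"

definition lqr_cost ::
  "real^'n^'n \<Rightarrow> real^'m^'m \<Rightarrow> real^'n^'n \<Rightarrow> real^'n^'m \<Rightarrow> real" where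
  "lqr_cost Q R P K = trace (Q ** P + transpose K ** R ** K ** P)"

text \<open>The \<open>H\<^sub>2\<close> norm of the transfer function from \<open>d\<close> to \<open>z = (Q\<^bsup>1/2\<^esup> x, R\<^bsup>1/2\<^esup> u)\<close>
  of the loop closed with \<open>u = K x\<close>, expressed through the controllability Gramian;
  meaningful only when \<open>A + B K\<close> is Schur, in which case the Gramian is unique.\<close>

definition H2_norm ::
  "real^'n^'n \<Rightarrow> real^'m^'n \<Rightarrow> real^'n^'n \<Rightarrow> real^'m^'m \<Rightarrow> real^'n^'m \<Rightarrow> real" where
  "H2_norm A B Q R K = sqrt (lqr_cost Q R (THE P. lyapunov A B K P = 0) K)"

definition optimal_gain ::
  "real^'n^'n \<Rightarrow> real^'m^'n \<Rightarrow> real^'n^'n \<Rightarrow> real^'m^'m \<Rightarrow> real^'n^'m" where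
  "optimal_gain A B Q R =
    (THE K. is_arg_min (H2_norm A B Q R) (\<lambda>K. Schur (A + B ** K)) K)"


section \<open>Data\<close>

text \<open>The number \<open>T\<close> of samples varies within the statements, so a matrix with \<open>T\<close> columns
  is given by \<open>T\<close> together with its sequence of columns \<open>M 0, \<dots>, M (T - 1)\<close>;
  later values of the sequence are irrelevant. Thus \<open>U\<^sub>0\<close>, \<open>X\<^sub>0\<close>, \<open>X\<^sub>1\<close>, \<open>D\<^sub>0\<close> are
  the sequences \<open>u\<close>, \<open>x\<close>, \<open>\<lambda>k. x (k + 1)\<close>, \<open>d\<close>.\<close>

definition data_rank :: "nat \<Rightarrow> (nat \<Rightarrow> real^'r) \<Rightarrow> nat" where
  "data_rank T M = dim (M ` {..<T})"

definition frobenius :: "nat \<Rightarrow> (nat \<Rightarrow> real^'r) \<Rightarrow> real" where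
  "frobenius T M = sqrt (\<Sum>k<T. \<Sum>i\<in>UNIV. (M k $ i)\<^sup>2)"

definition gram :: "nat \<Rightarrow> (nat \<Rightarrow> real^'r) \<Rightarrow> real^'r^'r" where
  "gram T M = (\<chi> i j. \<Sum>k<T. M k $ i * M k $ j)"

text \<open>Square roots of the eigenvalues of \<open>M M\<^sup>T\<close>. For \<open>T\<close> at least the number of rows these are
  the singular values of \<open>M\<close>. For smaller \<open>T\<close> there is the additional value 0, which is
  irrelevant for the maximum; the minimum is used only for \<open>M\<close> of full row rank.\<close>

definition singular_values :: "nat \<Rightarrow> (nat \<Rightarrow> real^'r) \<Rightarrow> real set" where
  "singular_values T M = {sqrt l | l. \<exists>v. v \<noteq> 0 \<and> gram T M *v v = l *s v}"

definition sigma_min :: "nat \<Rightarrow> (nat \<Rightarrow> real^'r) \<Rightarrow> real" where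
  "sigma_min T M = Min (singular_values T M)"

definition sigma_max :: "nat \<Rightarrow> (nat \<Rightarrow> real^'r) \<Rightarrow> real" where
  "sigma_max T M = Max (singular_values T M)"

definition W0 :: "(nat \<Rightarrow> real^'m) \<Rightarrow> (nat \<Rightarrow> real^'n) \<Rightarrow> nat \<Rightarrow> real^('m + 'n)" where
  "W0 u x k = (\<chi> i. case i of Inl a \<Rightarrow> u k $ a | Inr b \<Rightarrow> x k $ b)"

definition trajectory ::
  "real^'n^'n \<Rightarrow> real^'m^'n \<Rightarrow> nat \<Rightarrow>
    (nat \<Rightarrow> real^'m) \<Rightarrow> (nat \<Rightarrow> real^'n) \<Rightarrow> (nat \<Rightarrow> real^'n) \<Rightarrow> bool" where
  "trajectory A B T u x d \<longleftrightarrow> (\<forall>k<T. x (k + 1) = A *v x k + B *v u k + d k)"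

text \<open>In \<^typ>\<open>ereal\<close>, a positive number divided by 0 is \<open>\<infinity>\<close>.\<close>

definition SNR ::
  "nat \<Rightarrow> (nat \<Rightarrow> real^'m) \<Rightarrow> (nat \<Rightarrow> real^'n) \<Rightarrow> (nat \<Rightarrow> real^'n) \<Rightarrow> ereal" where
  "SNR T u x d = ereal (sigma_min T (W0 u x)) / ereal (sigma_max T d)"


section \<open>The indirect certainty-equivalence problem\<close>

definition block_row :: "real^'m^'n \<Rightarrow> real^'n^'n \<Rightarrow> real^('m + 'n)^'n" where
  "block_row B A = (\<chi> i j. case j of Inl a \<Rightarrow> B $ i $ a | Inr b \<Rightarrow> A $ i $ b)"

definition ls_estimate ::
  "nat \<Rightarrow> (nat \<Rightarrow> real^'m) \<Rightarrow> (nat \<Rightarrow> real^'n) \<Rightarrow> (real^'m^'n) \<times> (real^'n^'n)" where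
  "ls_estimate T u x =
    arg_min (\<lambda>(B, A). frobenius T (\<lambda>k. x (k + 1) - block_row B A *v W0 u x k)) (\<lambda>_. True)"

definition ce_feasible ::
  "nat \<Rightarrow> (nat \<Rightarrow> real^'m) \<Rightarrow> (nat \<Rightarrow> real^'n) \<Rightarrow> (real^'n^'n) \<times> (real^'n^'m) \<Rightarrow> bool" where
  "ce_feasible T u x = (\<lambda>(P, K). case ls_estimate T u x of (Bh, Ah) \<Rightarrow>
    transpose P = P \<and> loewner_le (mat 1) P \<and> loewner_le (lyapunov Ah Bh K P) 0)"

definition ce_optimal ::
  "real^'n^'n \<Rightarrow> real^'m^'m \<Rightarrow> nat \<Rightarrow> (nat \<Rightarrow> real^'m) \<Rightarrow> (nat \<Rightarrow> real^'n) \<Rightarrow>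
    (real^'n^'n) \<times> (real^'n^'m) \<Rightarrow> bool" where
  "ce_optimal Q R T u x = is_arg_min (\<lambda>(P, K). lqr_cost Q R P K) (ce_feasible T u x)"

end

theory Submission
  imports Defs "HOL-Computational_Algebra.Fundamental_Theorem_Algebra"
begin

text \<open>A minimiser \<open>(P, K)\<close> of the cost subject to the Lyapunov inequality bounds the Gramian of
  its own loop, so minimising over \<open>(P, K)\<close> amounts to minimising the \<open>H\<^sub>2\<close> norm over \<open>K\<close>. If
  \<open>(P, K)\<close> is feasible for \<open>(A, B)\<close> and \<open>P\<close>, \<open>K\<close> are bounded, then a small change of
  \<open>(A, B)\<close> violates the inequality by at most \<open>\<eta> I\<close>, and \<open>P / (1 - \<eta>)\<close> repairs
  it. Going from the true optimum to the estimated system and from its optimum back to the true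
  system costs two factors \<open>1 / (1 - \<eta>)\<close>; coercivity of the cost provides the bounds on \<open>P\<close>
  and \<open>K\<close>, uniformly in the data. The estimation error is at most a multiple of \<open>1 / SNR\<close>.\<close>

section \<open>Quadratic forms\<close>

text \<open>The constraints of (I) are closed quadratic inequalities, whereas \<open>Schur\<close>
  speaks of complex eigenvalues. The bridge is the convergence of all iterates to 0. It is obtained
  without a Jordan form: the iterates of a single vector satisfy a polynomial relation, whose roots
  are split off one at a time.

  Bounds on \<open>P\<close> and \<open>K\<close> that depended on the estimated system would make
  the perturbation argument circular. They do not: the coercivity constant depends on
  \<open>Q\<close> and \<open>R\<close> only, and with \<eta> < 1/2 the optimum of the estimated
  system costs at most twice the true optimum. So the bounds are fixed before the admissible model
  error \<delta> is chosen, and \<delta> in turn fixes the threshold on the signal-to-noise ratio.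

  \<open>optimal_gain\<close> is a definite description, so nothing is known about it until the
  minimising gain is shown to be unique. This rests on convexity in \<open>(P, K P)\<close>, with
  strictness coming from \<open>R\<close> and from \<open>P\<close> dominating the identity.\<close>

lemma quadratic_form_add:
  fixes H :: "real^'n^'n"
  assumes "transpose H = H"
  shows "(v + t *\<^sub>R w) \<bullet> (H *v (v + t *\<^sub>R w))
    = v \<bullet> (H *v v) + 2 * t * (w \<bullet> (H *v v)) + t\<^sup>2 * (w \<bullet> (H *v w))"
proof -
  have "v \<bullet> (H *v w) = w \<bullet> (H *v v)"
    by (metis assms dot_lmul_matrix inner_commute vector_transpose_matrix)
  then show ?thesis
    by (simp add: matrix_vector_right_distrib matrix_vector_mult_scaleR inner_add_left
        inner_add_right power2_eq_square algebra_simps)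
qed

text \<open>Along the line \<open>v + t w\<close> with \<open>w = H v\<close> the form is a
  nonnegative quadratic in \<open>t\<close> without constant term, so its linear coefficient, twice
  the squared norm of \<open>H v\<close>, must vanish.\<close>

lemma pos_semidef_kernel:
  assumes "pos_semidef H" "v \<bullet> (H *v v) = 0"
  shows "H *v v = 0"
proof -
  define w where "w = H *v v"
  define s where "s = w \<bullet> w"
  define c where "c = w \<bullet> (H *v w)"
  have c: "c \<ge> 0" and H: "transpose H = H"
    using assms(1) by (auto simp: c_def pos_semidef_def)
  \<comment> \<open>The minimiser of the quadratic with \<open>c + 1\<close> in place of
    \<open>c\<close>, which keeps the denominator positive when \<open>c = 0\<close>.\<close>
  define t where "t = - s / (c + 1)"
  have "0 \<le> (v + t *\<^sub>R w) \<bullet> (H *v (v + t *\<^sub>R w))"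
    using assms(1) by (simp add: pos_semidef_def)
  also have "\<dots> = 2 * t * s + t\<^sup>2 * c"
    using assms(2) by (simp add: quadratic_form_add[OF H] s_def c_def flip: w_def)
  also have "\<dots> \<le> 2 * t * s + t\<^sup>2 * (c + 1)"
    by (simp add: algebra_simps)
  also have "\<dots> = - s\<^sup>2 / (c + 1)"
    using c by (simp add: t_def power2_eq_square divide_simps)
  finally have "s\<^sup>2 \<le> 0"
    using c by (simp add: divide_simps split: if_splits)
  then show ?thesis
    by (simp add: s_def w_def)
qed

text \<open>A minimiser \<open>v\<close> of the form on the unit sphere is an eigenvector: with
  \<open>l\<close> the minimum, \<open>G - l I\<close> is positive semidefinite and its form
  vanishes at \<open>v\<close>, so \<open>v\<close> lies in its kernel.\<close>

lemma symmetric_min_eigenvalue: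
  fixes G :: "real^'n^'n"
  assumes "transpose G = G"
  obtains l v where "v \<noteq> 0" "G *v v = l *s v" "\<forall>w. l * (w \<bullet> w) \<le> w \<bullet> (G *v w)"
proof -
  have ne: "sphere (0::real^'n) 1 \<noteq> {}"
    by (auto intro!: exI[of _ "axis undefined 1"] simp: norm_axis_1)
  have cont: "continuous_on (sphere 0 1) (\<lambda>v. v \<bullet> (G *v v))"
    by (intro continuous_intros linear_continuous_on matrix_vector_mul_bounded_linear)
  obtain v where v: "norm v = 1" and min: "\<And>w. norm w = 1 \<Longrightarrow> v \<bullet> (G *v v) \<le> w \<bullet> (G *v w)"
    using continuous_attains_inf[OF compact_sphere ne cont] by auto
  define l where "l = v \<bullet> (G *v v)"
  have bound: "l * (w \<bullet> w) \<le> w \<bullet> (G *v w)" for w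
  proof (cases "w = 0")
    case False
    have "l \<le> (w /\<^sub>R norm w) \<bullet> (G *v (w /\<^sub>R norm w))"
      unfolding l_def using False by (intro min) simp
    also have "\<dots> = (w \<bullet> (G *v w)) / (norm w)\<^sup>2"
      by (simp add: matrix_vector_mult_scaleR power2_eq_square field_simps)
    finally show ?thesis
      using False by (simp add: field_simps power2_norm_eq_inner)
  qed simp
  define H where "H = G - l *\<^sub>R mat 1"
  have H: "H *v w = G *v w - l *\<^sub>R w" for w
    by (simp add: H_def matrix_vector_mult_diff_rdistrib scaleR_matrix_vector_assoc[symmetric])
  have "pos_semidef H"
    unfolding pos_semidef_def
  proof
    show "transpose H = H"
      using assms by (simp add: H_def transpose_def vec_eq_iff mat_def)
  qed (use bound in \<open>simp add: H inner_diff_right\<close>)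
  moreover have "v \<bullet> (H *v v) = 0"
    using v by (simp add: H inner_diff_right l_def norm_eq_1)
  ultimately have "H *v v = 0"
    by (rule pos_semidef_kernel)
  then have "G *v v = l *s v"
    by (simp add: H scalar_mult_eq_scaleR)
  moreover have "v \<noteq> 0"
    using v by auto
  ultimately show thesis
    using bound that by blast
qed

lemma pos_def_lower_bound:
  fixes S :: "real^'n^'n"
  assumes "pos_def S"
  obtains c where "c > 0" "\<forall>v. c * (v \<bullet> v) \<le> v \<bullet> (S *v v)"
proof -
  have "transpose S = S"
    using assms by (simp add: pos_def_def)
  then obtain l v where v: "v \<noteq> 0" "S *v v = l *s v" and l: "\<forall>w. l * (w \<bullet> w) \<le> w \<bullet> (S *v w)"
    by (rule symmetric_min_eigenvalue)
  have "0 < v \<bullet> (S *v v)"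
    using assms v(1) unfolding pos_def_def by blast
  also have "v \<bullet> (S *v v) = l * (v \<bullet> v)"
    by (simp add: v(2) scalar_mult_eq_scaleR)
  finally have "l > 0"
    using inner_ge_zero[of v] by (auto simp: zero_less_mult_iff)
  then show thesis
    using l that by blast
qed

text \<open>Elimination: subtracting \<open>(P e\<^sub>i) (P e\<^sub>i)\<^sup>T / P\<^sub>i\<^sub>i\<close> from \<open>P\<close>
  clears a diagonal entry, preserves semidefiniteness and lowers the trace
  by the nonnegative number \<open>(P e\<^sub>i) \<bullet> S (P e\<^sub>i) / P\<^sub>i\<^sub>i\<close>.\<close>

lemma trace_mult_nonneg:
  fixes S P :: "real^'n^'n"
  assumes S: "pos_semidef S" and P: "pos_semidef P"
  shows "0 \<le> trace (S ** P)"
  using P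
proof (induction "card {i. P $ i $ i \<noteq> 0}" arbitrary: P rule: less_induct)
  case less
  have sym: "transpose P = P" and psd: "\<And>v. 0 \<le> v \<bullet> (P *v v)"
    using less.prems by (auto simp: pos_semidef_def)
  have sym': "P $ i $ j = P $ j $ i" for i j
    using arg_cong[OF sym, of "\<lambda>X. X $ i $ j"] by (simp add: transpose_def)
  have diag: "P $ i $ i = axis i 1 \<bullet> (P *v axis i 1)" for i
    by (simp add: matrix_vector_mul_component inner_axis inner_axis')
  show ?case
  proof (cases "\<exists>i. P $ i $ i \<noteq> 0")
    case False
    then have "P *v axis i 1 = 0" for i
      using pos_semidef_kernel[OF less.prems] diag by simp
    then have "P = 0"
      by (metis matrix_vector_mult_basis column_def vec_eq_iff vec_lambda_beta zero_index)
    then show ?thesis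
      by (simp add: trace_def)
  next
    case True
    then obtain i where i: "P $ i $ i \<noteq> 0"
      by blast
    define c where "c = P $ i $ i"
    have c: "c > 0"
      using i psd[of "axis i 1"] by (simp add: c_def diag)
    define p where "p = P *v axis i 1"
    have p: "p $ j = P $ j $ i" for j
      by (simp add: p_def matrix_vector_mult_basis column_def)
    define P' where "P' = P - (1 / c) *\<^sub>R (\<chi> j k. p $ j * p $ k)"
    have P'v: "P' *v w = P *v w - ((p \<bullet> w) / c) *\<^sub>R p" for w
      by (simp add: P'_def vec_eq_iff matrix_vector_mult_def inner_vec_def sum_subtractf
          algebra_simps sum_distrib_left sum_divide_distrib)
    have symP': "transpose P' = P'"
      by (simp add: P'_def transpose_def vec_eq_iff sym' mult.commute)
    have psdP': "0 \<le> w \<bullet> (P' *v w)" for w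
    proof -
      \<comment> \<open>The minimiser of the form of \<open>P\<close> along
        \<open>w + t e\<^sub>i\<close>; the minimum is the form of \<open>P'\<close> at
        \<open>w\<close>.\<close>
      define t where "t = - (p \<bullet> w) / c"
      have "0 \<le> (w + t *\<^sub>R axis i 1) \<bullet> (P *v (w + t *\<^sub>R axis i 1))"
        by (rule psd)
      also have "\<dots> = w \<bullet> (P *v w) + 2 * t * (axis i 1 \<bullet> (P *v w)) + t\<^sup>2 * c"
        by (simp add: quadratic_form_add[OF sym] diag c_def)
      also have "axis i 1 \<bullet> (P *v w) = p \<bullet> w"
        by (metis p_def sym dot_lmul_matrix inner_commute vector_transpose_matrix)
      finally show ?thesis
        using c by (simp add: P'v inner_diff_right t_def power2_eq_square inner_commute divide_simps)
    qed
    have P': "pos_semidef P'"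
      using symP' psdP' by (simp add: pos_semidef_def)
    have diag': "P' $ j $ j = P $ j $ j - (P $ j $ i)\<^sup>2 / c" for j
      by (simp add: P'_def p power2_eq_square)
    \<comment> \<open>An entry already cleared stays cleared: elimination could only make it
      negative, which semidefiniteness of \<open>P'\<close> forbids. Hence the number of nonzero
      diagonal entries drops.\<close>
    have "P' $ j $ j = 0" if "P $ j $ j = 0" for j
    proof -
      have "0 \<le> P' $ j $ j"
        using psdP'[of "axis j 1"] by (simp add: matrix_vector_mul_component inner_axis inner_axis')
      then show ?thesis
        using c that by (simp add: diag' divide_simps)
    qed
    moreover have "P' $ i $ i = 0"
      using c by (simp add: diag' power2_eq_square flip: c_def)
    ultimately have "{j. P' $ j $ j \<noteq> 0} \<subset> {j. P $ j $ j \<noteq> 0}"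
      using i by blast
    then have "card {j. P' $ j $ j \<noteq> 0} < card {j. P $ j $ j \<noteq> 0}"
      by (intro psubset_card_mono) auto
    then have "0 \<le> trace (S ** P')"
      using less.hyps P' by blast
    moreover have "trace (S ** P) = trace (S ** P') + (p \<bullet> (S *v p)) / c"
    proof -
      have "P = P' + (1 / c) *\<^sub>R (\<chi> j k. p $ j * p $ k)"
        by (simp add: P'_def)
      then have "trace (S ** P) = trace (S ** P') + trace (S ** ((1 / c) *\<^sub>R (\<chi> j k. p $ j * p $ k)))"
        by (metis matrix_add_ldistrib trace_add)
      also have "trace (S ** ((1 / c) *\<^sub>R (\<chi> j k. p $ j * p $ k))) = (p \<bullet> (S *v p)) / c"
        by (simp add: trace_def matrix_matrix_mult_def inner_vec_def matrix_vector_mult_def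
            sum_distrib_left sum_divide_distrib mult_ac)
      finally show ?thesis .
    qed
    moreover have "0 \<le> p \<bullet> (S *v p)"
      using S by (simp add: pos_semidef_def)
    ultimately show ?thesis
      using c by simp
  qed
qed

section \<open>Schur matrices and iteration\<close>


lemma tendsto_0_recurrence:
  fixes a b :: "nat \<Rightarrow> complex"
  assumes rec: "\<And>k. a (Suc k) = z * a k + b k" and b: "b \<longlonglongrightarrow> 0" and z: "cmod z < 1"
  shows "a \<longlonglongrightarrow> 0"
proof (rule LIMSEQ_I)
  fix e :: real assume e: "e > 0"
  define r where "r = cmod z"
  have r: "0 \<le> r" "r < 1"
    using z by (auto simp: r_def)
  \<comment> \<open>With this bound on the inhomogeneity, \<open>e / 2\<close> is a fixed point of
    the majorising recurrence \<open>y \<mapsto> r y + (1 - r) e / 2\<close>.\<close>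
  have "0 < (1 - r) * (e / 2)"
    using e r by simp
  from LIMSEQ_D[OF b this] obtain N where N: "\<And>k. k \<ge> N \<Longrightarrow> cmod (b k) < (1 - r) * (e / 2)"
    by auto
  have bound: "cmod (a (N + j)) \<le> r ^ j * cmod (a N) + e / 2" for j
  proof (induction j)
    case (Suc j)
    have "cmod (a (N + Suc j)) \<le> r * cmod (a (N + j)) + cmod (b (N + j))"
      by (metis add_Suc_right norm_mult norm_triangle_ineq r_def rec)
    also have "\<dots> \<le> r * (r ^ j * cmod (a N) + e / 2) + (1 - r) * (e / 2)"
      using Suc N[of "N + j"] r by (intro add_mono mult_left_mono) auto
    finally show ?case
      by (simp add: field_simps)
  qed (use e in simp)
  have "(\<lambda>j. r ^ j * cmod (a N)) \<longlonglongrightarrow> 0"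
    using r by (intro tendsto_mult_left_zero LIMSEQ_realpow_zero)
  from LIMSEQ_D[OF this, of "e / 2"] e
  obtain M where M: "\<And>j. j \<ge> M \<Longrightarrow> \<bar>r ^ j * cmod (a N)\<bar> < e / 2"
    by auto
  show "\<exists>no. \<forall>k\<ge>no. norm (a k - 0) < e"
  proof (intro exI allI impI)
    fix k assume "N + M \<le> k"
    define j where "j = k - N"
    have "k = N + j" "j \<ge> M"
      using \<open>N + M \<le> k\<close> by (auto simp: j_def)
    then show "norm (a k - 0) < e"
      using bound[of j] M[of j] by simp
  qed
qed

section \<open>Iterates of a complex matrix\<close>

lemma vec_tendsto_0_iff:
  fixes f :: "nat \<Rightarrow> 'a::real_normed_vector^'n"
  shows "f \<longlonglongrightarrow> 0 \<longleftrightarrow> (\<forall>i. (\<lambda>k. f k $ i) \<longlonglongrightarrow> 0)"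
  using tendsto_vec_nth[of f 0] vec_tendstoI[of f 0] by auto

lemma matrix_vector_mult_smult:
  fixes F :: "'a::comm_semiring_1^'n^'m"
  shows "F *v (c *s v) = c *s (F *v v)"
  by (simp add: vec_eq_iff matrix_vector_mult_def sum_distrib_left ac_simps)

lemma iterate_matrix_commute: "F *v ((((*v) F) ^^ k) v) = (((*v) F) ^^ k) (F *v v)"
  by (rule funpow_swap1)

lemma iterate_matrix_diff:
  fixes F :: "complex^'n^'n"
  shows "(((*v) F) ^^ k) (v - w) = (((*v) F) ^^ k) v - (((*v) F) ^^ k) w"
  by (induction k) (simp_all add: matrix_vector_mult_diff_distrib)

lemma iterate_matrix_smult:
  fixes F :: "complex^'n^'n"
  shows "(((*v) F) ^^ k) (c *s v) = c *s (((*v) F) ^^ k) v"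
  by (induction k) (simp_all add: matrix_vector_mult_smult)

text \<open>Either \<open>F\<^bsup>k+1\<^esup> v = z F\<^bsup>k\<^esup> v + F\<^bsup>k\<^esup> (F v - z v)\<close> contracts, or \<open>F - z\<close> is
  invertible and commutes with \<open>F\<^bsup>k\<^esup>\<close>.\<close>

lemma iterates_tendsto_0_step:
  fixes F :: "complex^'n^'n"
  assumes eig: "\<And>v. v \<noteq> 0 \<Longrightarrow> F *v v = z *s v \<Longrightarrow> cmod z < 1"
    and lim: "(\<lambda>k. (((*v) F) ^^ k) (F *v v - z *s v)) \<longlonglongrightarrow> 0"
  shows "(\<lambda>k. (((*v) F) ^^ k) v) \<longlonglongrightarrow> 0"
proof (cases "cmod z < 1")
  case True
  have step: "(((*v) F) ^^ Suc k) v = z *s (((*v) F) ^^ k) v + (((*v) F) ^^ k) (F *v v - z *s v)" for k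
    by (simp add: iterate_matrix_diff iterate_matrix_smult iterate_matrix_commute)
  have "(\<lambda>k. (((*v) F) ^^ k) v $ i) \<longlonglongrightarrow> 0" for i
  proof (rule tendsto_0_recurrence[OF _ _ True])
    show "(((*v) F) ^^ Suc k) v $ i
        = z * (((*v) F) ^^ k) v $ i + (((*v) F) ^^ k) (F *v v - z *s v) $ i" for k
      by (simp only: step vector_add_component vector_smult_component)
    show "(\<lambda>k. (((*v) F) ^^ k) (F *v v - z *s v) $ i) \<longlonglongrightarrow> 0"
      using lim unfolding vec_tendsto_0_iff by blast
  qed
  then show ?thesis
    by (simp add: vec_tendsto_0_iff)
next
  case False
  define G where "G = F - mat z"
  have G: "G *v w = F *v w - z *s w" for w
  proof -
    have "mat z *v w = z *s w"
      by (simp add: vec_eq_iff matrix_vector_mult_def mat_def if_distrib[where f = "\<lambda>x. x * y" for y]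
          cong: if_cong)
    then show ?thesis
      by (simp add: G_def matrix_vector_mult_diff_rdistrib)
  qed
  have "inj ((*v) G)"
  proof (rule injI)
    fix x y assume "G *v x = G *v y"
    then have "G *v (x - y) = 0"
      by (simp add: matrix_vector_mult_diff_distrib)
    then show "x = y"
      using eig[of "x - y"] False by (auto simp: G)
  qed
  then obtain g where g: "linear g" "g \<circ> (*v) G = id"
    using linear_injective_left_inverse[OF matrix_vector_mul_linear] by blast
  from g(2) have gG: "g (G *v w) = w" for w
    by (simp add: fun_eq_iff)
  have comm: "G *v ((((*v) F) ^^ k) v) = (((*v) F) ^^ k) (F *v v - z *s v)" for k
    by (simp only: G iterate_matrix_diff iterate_matrix_smult iterate_matrix_commute)
  have "g ((((*v) F) ^^ k) (F *v v - z *s v)) = (((*v) F) ^^ k) v" for k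
    by (simp only: gG flip: comm)
  moreover have "(\<lambda>k. g ((((*v) F) ^^ k) (F *v v - z *s v))) \<longlonglongrightarrow> g 0"
    by (rule bounded_linear.tendsto[OF _ lim]) (use g(1) linear_conv_bounded_linear in blast)
  ultimately show ?thesis
    using g(1) by (simp add: linear_0)
qed

text \<open>If \<open>z\<close> is a root of \<open>p\<close> and \<open>p = (X - z) q\<close>, then
  \<open>q\<close> annihilates \<open>F v - z v\<close>. The induction gives convergence for that
  vector, and the preceding lemma lifts it to \<open>v\<close>, whether or not \<open>z\<close> is
  an eigenvalue.\<close>

lemma iterates_tendsto_0_annihilator:
  fixes F :: "complex^'n^'n" and p :: "complex poly"
  assumes eig: "\<And>z v. v \<noteq> 0 \<Longrightarrow> F *v v = z *s v \<Longrightarrow> cmod z < 1"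
    and "p \<noteq> 0" "(\<Sum>i\<le>degree p. coeff p i *s (((*v) F) ^^ i) v) = 0"
  shows "(\<lambda>k. (((*v) F) ^^ k) v) \<longlonglongrightarrow> 0"
  using assms(2,3)
proof (induction "degree p" arbitrary: p v)
  case 0
  then have "coeff p 0 \<noteq> 0"
    by (metis leading_coeff_0_iff)
  then have "v = 0"
    using 0 by simp
  then have "(((*v) F) ^^ k) v = 0" for k
    by (induction k) auto
  then show ?case
    by simp
next
  case (Suc N)
  then have "\<not> constant (poly p)"
    by (simp add: constant_degree)
  then obtain z where "poly p z = 0"
    using fundamental_theorem_of_algebra by blast
  then obtain q where q: "p = [:- z, 1:] * q"
    by (auto simp: poly_eq_0_iff_dvd)
  have q0: "q \<noteq> 0"
    using Suc.prems q by auto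
  have "degree p = degree [:- z, 1:] + degree q"
    unfolding q by (rule degree_mult_eq) (use q0 in auto)
  then have N: "N = degree q"
    using Suc.hyps(2) by simp
  have coeff: "coeff p i = (case i of 0 \<Rightarrow> 0 | Suc j \<Rightarrow> coeff q j) - z * coeff q i" for i
    by (simp add: q coeff_pCons split: nat.split)
  have "(\<Sum>i\<le>Suc N. coeff p i *s (((*v) F) ^^ i) v) =
      (\<Sum>i\<le>Suc N. (case i of 0 \<Rightarrow> 0 | Suc j \<Rightarrow> coeff q j) *s (((*v) F) ^^ i) v)
      - (\<Sum>i\<le>Suc N. (z * coeff q i) *s (((*v) F) ^^ i) v)"
    by (simp only: coeff vector_sub_rdistrib sum_subtractf)
  also have "(\<Sum>i\<le>Suc N. (case i of 0 \<Rightarrow> 0 | Suc j \<Rightarrow> coeff q j) *s (((*v) F) ^^ i) v)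
      = (\<Sum>i\<le>N. coeff q i *s (((*v) F) ^^ Suc i) v)"
    by (subst sum.atMost_Suc_shift) simp
  also have "(\<Sum>i\<le>Suc N. (z * coeff q i) *s (((*v) F) ^^ i) v)
      = (\<Sum>i\<le>N. (z * coeff q i) *s (((*v) F) ^^ i) v)"
    by (simp add: N coeff_eq_0)
  also have "(\<Sum>i\<le>N. coeff q i *s (((*v) F) ^^ Suc i) v) - (\<Sum>i\<le>N. (z * coeff q i) *s (((*v) F) ^^ i) v)
      = (\<Sum>i\<le>N. coeff q i *s (((*v) F) ^^ i) (F *v v - z *s v))"
    by (simp add: iterate_matrix_diff iterate_matrix_smult iterate_matrix_commute vector_ssub_ldistrib
        vector_smult_assoc mult.commute sum_subtractf)
  finally have "(\<Sum>i\<le>degree q. coeff q i *s (((*v) F) ^^ i) (F *v v - z *s v)) = 0"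
    using Suc.prems(2) unfolding Suc.hyps(2)[symmetric] N by (rule trans[OF sym])
  from Suc.hyps(1)[OF N q0 this] show ?case
    using eig by (intro iterates_tendsto_0_step) blast+
qed

lemma span_image_lessThanE:
  fixes f :: "nat \<Rightarrow> 'a::real_vector"
  assumes "x \<in> span (f ` {..<k})"
  obtains c where "x = (\<Sum>i<k. c i *\<^sub>R f i)"
proof -
  have "\<exists>c. x = (\<Sum>i<k. c i *\<^sub>R f i)"
    using assms
  proof (induction k arbitrary: x)
    case (Suc k)
    then obtain a where "x - a *\<^sub>R f k \<in> span (f ` {..<k})"
      by (auto simp: lessThan_Suc span_breakdown_eq)
    with Suc.IH obtain c where "x - a *\<^sub>R f k = (\<Sum>i<k. c i *\<^sub>R f i)"
      by blast
    then show ?case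
      by (intro exI[of _ "c(k := a)"]) (simp add: algebra_simps)
  qed simp
  then show thesis
    using that by blast
qed

lemma euclidean_sequence_dependent:
  fixes f :: "nat \<Rightarrow> 'a::euclidean_space"
  obtains k where "f k \<in> span (f ` {..<k})"
proof -
  have "\<exists>k. f k \<in> span (f ` {..<k})"
  proof (rule ccontr)
    assume "\<nexists>k. f k \<in> span (f ` {..<k})"
    then have "dim (f ` {..<k}) = k" for k
      by (induction k) (simp_all add: lessThan_Suc dim_insert)
    then show False
      using dim_subset_UNIV[of "f ` {..<Suc DIM('a)}"] by simp
  qed
  then show thesis
    using that by blast
qed

lemma of_real_smult: "complex_of_real r *s v = r *\<^sub>R v"
  by (simp add: vec_eq_iff scaleR_conv_of_real[of _ "_ :: complex"])

lemma iterates_tendsto_0_complex: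
  fixes F :: "complex^'n^'n"
  assumes eig: "\<And>z v. v \<noteq> 0 \<Longrightarrow> F *v v = z *s v \<Longrightarrow> cmod z < 1"
  shows "(\<lambda>k. (((*v) F) ^^ k) v) \<longlonglongrightarrow> 0"
proof -
  define f where "f = (\<lambda>k. (((*v) F) ^^ k) v)"
  obtain k where "f k \<in> span (f ` {..<k})"
    by (rule euclidean_sequence_dependent)
  then obtain c where c: "f k = (\<Sum>i<k. c i *\<^sub>R f i)"
    by (rule span_image_lessThanE)
  \<comment> \<open>The linear relation read as a monic polynomial in \<open>F\<close> that
    annihilates \<open>v\<close>. The relation is over the reals because \<open>complex^'n\<close>
    is a Euclidean space over them, hence the embedding of the coefficients.\<close>
  define p where "p = monom 1 k - (\<Sum>i<k. monom (complex_of_real (c i)) i)"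
  have coeff: "coeff p i = (if i = k then 1 else if i < k then - complex_of_real (c i) else 0)" for i
    by (auto simp: p_def coeff_sum sum.delta)
  have "degree p = k"
    by (intro antisym degree_le le_degree) (auto simp: coeff)
  moreover have "p \<noteq> 0"
    using coeff[of k] by auto
  moreover have "(\<Sum>i\<le>k. coeff p i *s f i) = f k - (\<Sum>i<k. c i *\<^sub>R f i)"
  proof -
    have "(\<Sum>i\<le>k. coeff p i *s f i) = f k + (\<Sum>i<k. - (c i *\<^sub>R f i))"
      unfolding lessThan_Suc_atMost[symmetric] sum.lessThan_Suc
      by (simp add: coeff add.commute of_real_smult)
    then show ?thesis
      by (simp add: sum_negf)
  qed
  ultimately have "(\<Sum>i\<le>degree p. coeff p i *s f i) = 0"
    by (simp only: c diff_self)
  with eig \<open>p \<noteq> 0\<close> show ?thesis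
    unfolding f_def by (rule iterates_tendsto_0_annihilator)
qed

text \<open>The vector \<open>v + i w\<close>; a real matrix acts on its two parts
  separately.\<close>

definition complex_vec :: "real^'n \<Rightarrow> real^'n \<Rightarrow> complex^'n" where
  "complex_vec v w = (\<chi> i. Complex (v $ i) (w $ i))"

lemma map_matrix_complex_vec:
  "map_matrix complex_of_real M *v complex_vec v w = complex_vec (M *v v) (M *v w)"
  by (simp add: complex_vec_def vec_eq_iff matrix_vector_mult_def complex_eq_iff)

lemma iterate_complex_vec:
  fixes M :: "real^'n^'n"
  shows "(((*v) (map_matrix complex_of_real M)) ^^ k) (complex_vec v w)
    = complex_vec ((((*v) M) ^^ k) v) ((((*v) M) ^^ k) w)"
  by (induction k) (simp_all add: map_matrix_complex_vec)

text \<open>From left to right, the complex result is applied to \<open>v + i 0\<close>. Conversely,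
  the iterates of an eigenvector are \<open>z\<^sup>k v\<close>; their real and imaginary parts are
  iterates of real vectors, so a nonzero component of \<open>v\<close> forces
  \<open>z\<^sup>k\<close> to tend to 0. Afterwards complex eigenvalues no longer appear.\<close>

lemma Schur_iff_iterates_tendsto_0:
  fixes M :: "real^'n^'n"
  shows "Schur M \<longleftrightarrow> (\<forall>v. (\<lambda>k. (((*v) M) ^^ k) v) \<longlonglongrightarrow> 0)"
proof
  assume M: "Schur M"
  show "\<forall>v. (\<lambda>k. (((*v) M) ^^ k) v) \<longlonglongrightarrow> 0"
  proof
    fix v
    have "(\<lambda>k. (((*v) (map_matrix complex_of_real M)) ^^ k) (complex_vec v 0)) \<longlonglongrightarrow> 0"
      using M by (intro iterates_tendsto_0_complex) (auto simp: Schur_def)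
    then have "(\<lambda>k. Re (complex_vec ((((*v) M) ^^ k) v) ((((*v) M) ^^ k) 0) $ i)) \<longlonglongrightarrow> Re 0" for i
      by (intro tendsto_Re) (simp add: iterate_complex_vec vec_tendsto_0_iff)
    then show "(\<lambda>k. (((*v) M) ^^ k) v) \<longlonglongrightarrow> 0"
      by (simp add: vec_tendsto_0_iff complex_vec_def)
  qed
next
  assume lim: "\<forall>v. (\<lambda>k. (((*v) M) ^^ k) v) \<longlonglongrightarrow> 0"
  show "Schur M"
    unfolding Schur_def
  proof (intro allI impI, elim conjE)
    fix z and v :: "complex^'n"
    assume v: "v \<noteq> 0" and eig: "map_matrix complex_of_real M *v v = z *s v"
    define a b where "a = (\<chi> i. Re (v $ i))" and "b = (\<chi> i. Im (v $ i))"
    have ab: "v = complex_vec a b"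
      by (simp add: a_def b_def complex_vec_def vec_eq_iff)
    obtain i where i: "v $ i \<noteq> 0"
      using v by (auto simp: vec_eq_iff)
    have pow: "(((*v) (map_matrix complex_of_real M)) ^^ k) v = z ^ k *s v" for k
      by (induction k) (simp_all add: eig matrix_vector_mult_smult vector_smult_assoc mult.commute)
    have "(\<lambda>k. (((*v) M) ^^ k) a $ i) \<longlonglongrightarrow> 0" "(\<lambda>k. (((*v) M) ^^ k) b $ i) \<longlonglongrightarrow> 0"
      using lim by (simp_all add: vec_tendsto_0_iff)
    then have "(\<lambda>k. Complex ((((*v) M) ^^ k) a $ i) ((((*v) M) ^^ k) b $ i)) \<longlonglongrightarrow> Complex 0 0"
      by (rule tendsto_Complex)
    moreover have "Complex ((((*v) M) ^^ k) a $ i) ((((*v) M) ^^ k) b $ i) = z ^ k * v $ i" for k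
      using arg_cong[OF pow[of k], of "\<lambda>w. w $ i"]
      by (simp add: ab iterate_complex_vec) (simp add: complex_vec_def)
    ultimately have "(\<lambda>k. z ^ k * v $ i) \<longlonglongrightarrow> 0"
      by (simp add: zero_complex.code)
    then have "(\<lambda>k. z ^ k * v $ i / v $ i) \<longlonglongrightarrow> 0 / v $ i"
      by (rule tendsto_divide[OF _ tendsto_const i])
    then have "(\<lambda>k. z ^ k) \<longlonglongrightarrow> 0"
      using i by simp
    then have "\<forall>\<^sub>F k in sequentially. cmod (z ^ k) < 1"
      by (auto simp: tendsto_iff dist_norm elim: allE[of _ 1])
    then obtain k where "cmod (z ^ k) < 1"
      by (auto simp: eventually_sequentially)
    then show "cmod z < 1"
      by (metis not_less norm_power one_le_power)
  qed
qed

lemma inner_iterate_transpose: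
  fixes M :: "real^'n^'n"
  shows "(((\<lambda>v. v v* M) ^^ k) v) \<bullet> w = v \<bullet> ((((*v) M) ^^ k) w)"
  by (induction k arbitrary: w) (simp_all add: dot_lmul_matrix iterate_matrix_commute)

text \<open>Congruence by \<open>M\<close> in the Lyapunov equation acts on vectors through
  \<open>v v* M\<close>, not through \<open>M *v v\<close>. The two iterations are adjoint, so
  testing against the axis vectors transfers convergence in finite dimension.\<close>

lemma iterates_transpose_tendsto_0_iff:
  fixes M :: "real^'n^'n"
  shows "(\<forall>v. (\<lambda>k. ((\<lambda>v. v v* M) ^^ k) v) \<longlonglongrightarrow> 0) \<longleftrightarrow> (\<forall>v. (\<lambda>k. (((*v) M) ^^ k) v) \<longlonglongrightarrow> 0)"
proof -
  have comp: "x $ i = axis i 1 \<bullet> x" "x $ i = x \<bullet> axis i 1" for x :: "real^'n" and i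
    by (simp_all add: inner_axis inner_axis')
  show ?thesis
  proof (intro iffI allI)
    fix v assume "\<forall>v. (\<lambda>k. ((\<lambda>v. v v* M) ^^ k) v) \<longlonglongrightarrow> 0"
    then have "(\<lambda>k. ((\<lambda>v. v v* M) ^^ k) (axis i 1) \<bullet> v) \<longlonglongrightarrow> 0" for i
      using tendsto_inner[OF _ tendsto_const] by fastforce
    then show "(\<lambda>k. (((*v) M) ^^ k) v) \<longlonglongrightarrow> 0"
      by (simp add: vec_tendsto_0_iff comp(1) inner_iterate_transpose)
  next
    fix v assume "\<forall>v. (\<lambda>k. (((*v) M) ^^ k) v) \<longlonglongrightarrow> 0"
    then have "(\<lambda>k. v \<bullet> (((*v) M) ^^ k) (axis i 1)) \<longlonglongrightarrow> 0" for i
      using tendsto_inner[OF tendsto_const] by fastforce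
    then show "(\<lambda>k. ((\<lambda>v. v v* M) ^^ k) v) \<longlonglongrightarrow> 0"
      by (simp add: vec_tendsto_0_iff comp(2) inner_iterate_transpose)
  qed
qed

section \<open>Lyapunov inequalities\<close>


lemma matrix_mult_add_left:
  fixes X Y :: "real^'n^'m"
  shows "(X + Y) ** Z = X ** Z + Y ** Z"
  by (simp add: matrix_matrix_mult_def vec_eq_iff sum.distrib algebra_simps)

lemma matrix_mult_diff_left:
  fixes X Y :: "real^'n^'m"
  shows "(X - Y) ** Z = X ** Z - Y ** Z"
  by (simp add: matrix_matrix_mult_def vec_eq_iff sum_subtractf algebra_simps)

lemma matrix_mult_diff_right:
  fixes X Y :: "real^'n^'m"
  shows "Z ** (X - Y) = Z ** X - Z ** Y"
  by (simp add: matrix_matrix_mult_def vec_eq_iff sum_subtractf algebra_simps)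

lemma matrix_mult_scaleR_left:
  fixes X :: "real^'n^'m"
  shows "(c *\<^sub>R X) ** Z = c *\<^sub>R (X ** Z)"
  by (simp add: matrix_matrix_mult_def vec_eq_iff sum_distrib_left algebra_simps)

lemma matrix_mult_scaleR_right:
  fixes X :: "real^'n^'m"
  shows "Z ** (c *\<^sub>R X) = c *\<^sub>R (Z ** X)"
  by (simp add: matrix_matrix_mult_def vec_eq_iff sum_distrib_left algebra_simps)

lemma transpose_add: "transpose (X + Y) = transpose X + transpose Y"
  by (simp add: transpose_def vec_eq_iff)

lemma transpose_diff: "transpose (X - Y) = transpose X - transpose Y"
  by (simp add: transpose_def vec_eq_iff)

lemma transpose_zero: "transpose 0 = 0"
  by (simp add: transpose_def vec_eq_iff)

lemma trace_scaleR: "trace (c *\<^sub>R X) = c * trace (X :: real^'n^'n)"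
  by (simp add: trace_def sum_distrib_left)

lemma inner_congruence:
  fixes M :: "real^'n^'m"
  shows "v \<bullet> ((M ** P ** transpose M) *v w) = (v v* M) \<bullet> (P *v (w v* M))"
  by (simp add: dot_lmul_matrix flip: matrix_vector_mul_assoc)

lemma transpose_congruence:
  fixes M :: "real^'n^'m"
  shows "transpose P = P \<Longrightarrow> transpose (M ** P ** transpose M) = M ** P ** transpose M"
  by (simp add: matrix_transpose_mul matrix_mul_assoc)

lemma pos_semidef_congruence:
  fixes M :: "real^'n^'m"
  shows "pos_semidef P \<Longrightarrow> pos_semidef (M ** P ** transpose M)"
  by (simp add: pos_semidef_def transpose_congruence inner_congruence)

lemma Schur_iff_transpose_iterates_tendsto_0:
  fixes M :: "real^'n^'n"
  shows "Schur M \<longleftrightarrow> (\<forall>v. (\<lambda>k. ((\<lambda>v. v v* M) ^^ k) v) \<longlonglongrightarrow> 0)"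
  by (simp only: Schur_iff_iterates_tendsto_0 iterates_transpose_tendsto_0_iff)

lemma tendsto_inner_matrix_iterates:
  fixes M X :: "real^'n^'n"
  assumes "Schur M"
  shows "(\<lambda>k. ((\<lambda>v. v v* M) ^^ k) v \<bullet> (X *v (((\<lambda>v. v v* M) ^^ k) w))) \<longlonglongrightarrow> 0"
proof -
  have "(\<lambda>k. ((\<lambda>v. v v* M) ^^ k) v) \<longlonglongrightarrow> 0" "(\<lambda>k. ((\<lambda>v. v v* M) ^^ k) w) \<longlonglongrightarrow> 0"
    using assms unfolding Schur_iff_transpose_iterates_tendsto_0 by blast+
  then have "(\<lambda>k. ((\<lambda>v. v v* M) ^^ k) v \<bullet> (X *v (((\<lambda>v. v v* M) ^^ k) w))) \<longlonglongrightarrow> 0 \<bullet> (X *v 0)"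
    by (intro tendsto_inner bounded_linear.tendsto[OF matrix_vector_mul_bounded_linear])
  then show ?thesis
    by simp
qed

text \<open>The constraints of (I) for a fixed closed loop \<open>M\<close>, as quadratic forms. The
  lower bound by the identity excludes indefinite solutions of the Lyapunov inequality, which exist
  for unstable loops too.\<close>

definition subgramian :: "real^'n^'n \<Rightarrow> real^'n^'n \<Rightarrow> bool" where
  "subgramian M P \<longleftrightarrow> transpose P = P \<and> (\<forall>v. v \<bullet> v \<le> v \<bullet> (P *v v)) \<and>
    (\<forall>v. v \<bullet> v + (v v* M) \<bullet> (P *v (v v* M)) \<le> v \<bullet> (P *v v))"

lemma subgramian_iff_loewner:
  "subgramian (A + B ** K) P \<longleftrightarrow>
    transpose P = P \<and> loewner_le (mat 1) P \<and> loewner_le (lyapunov A B K P) 0"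
proof -
  define M where "M = A + B ** K"
  have "transpose (0 - (M ** P ** transpose M - P + mat 1)) = 0 - (M ** P ** transpose M - P + mat 1)"
    if "transpose P = P"
    using transpose_congruence[OF that, of M] that
    by (simp only: transpose_diff transpose_add transpose_mat transpose_zero)
  moreover have "transpose (P - mat 1) = P - mat 1" if "transpose P = P"
    using that by (simp add: transpose_diff)
  moreover have "v \<bullet> ((0 - (M ** P ** transpose M - P + mat 1)) *v v)
      = v \<bullet> (P *v v) - (v \<bullet> v + (v v* M) \<bullet> (P *v (v v* M)))" for v
    by (simp add: matrix_vector_mult_diff_rdistrib matrix_vector_mult_add_rdistrib inner_diff_right
        inner_add_right inner_congruence)
  moreover have "v \<bullet> ((P - mat 1) *v v) = v \<bullet> (P *v v) - v \<bullet> v" for v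
    by (simp add: matrix_vector_mult_diff_rdistrib inner_diff_right)
  ultimately show ?thesis
    unfolding subgramian_def loewner_le_def pos_semidef_def lyapunov_def M_def[symmetric]
    by (auto simp only: diff_ge_0_iff_ge)
qed

lemma subgramian_pos_semidef: "subgramian M P \<Longrightarrow> pos_semidef P"
  by (meson inner_ge_zero order_trans pos_semidef_def subgramian_def)

text \<open>\<open>P\<close> is a Lyapunov function of the row iteration: each step lowers the form
  by at least the squared norm of the iterate. The form being nonnegative, these squared norms are
  summable, so the iterates tend to 0.\<close>

lemma subgramian_imp_Schur:
  assumes "subgramian M P"
  shows "Schur M"
  unfolding Schur_iff_transpose_iterates_tendsto_0
proof
  fix v
  define x where "x = (\<lambda>k. ((\<lambda>v. v v* M) ^^ k) v)"
  have "x k \<bullet> (P *v x k) + (\<Sum>j<k. x j \<bullet> x j) \<le> v \<bullet> (P *v v)" for k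
  proof (induction k)
    case (Suc k)
    have "x k \<bullet> x k + x (Suc k) \<bullet> (P *v x (Suc k)) \<le> x k \<bullet> (P *v x k)"
      using assms by (simp add: subgramian_def x_def)
    then show ?case
      using Suc by simp
  qed (simp add: x_def)
  moreover have "0 \<le> x k \<bullet> (P *v x k)" for k
    using subgramian_pos_semidef[OF assms] by (simp add: pos_semidef_def)
  ultimately have "(\<Sum>j<k. x j \<bullet> x j) \<le> v \<bullet> (P *v v)" for k
    by (smt (verit, best))
  then have "summable (\<lambda>j. x j \<bullet> x j)"
    by (intro summableI_nonneg_bounded) auto
  then have "(\<lambda>j. x j \<bullet> x j) \<longlonglongrightarrow> 0"
    by (rule summable_LIMSEQ_zero)
  then have "(\<lambda>j. sqrt (x j \<bullet> x j)) \<longlonglongrightarrow> sqrt 0"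
    by (rule tendsto_real_sqrt)
  then have "(\<lambda>j. norm (x j)) \<longlonglongrightarrow> 0"
    by (simp add: norm_eq_sqrt_inner)
  then show "(\<lambda>k. ((\<lambda>v. v v* M) ^^ k) v) \<longlonglongrightarrow> 0"
    unfolding x_def by (rule tendsto_norm_zero_cancel)
qed

text \<open>A comparison principle: along the row iteration the form never increases and tends to 0,
  so it starts nonnegative.\<close>

lemma Schur_form_nonneg:
  fixes M X :: "real^'n^'n"
  assumes M: "Schur M" and X: "\<And>v. (v v* M) \<bullet> (X *v (v v* M)) \<le> v \<bullet> (X *v v)"
  shows "0 \<le> v \<bullet> (X *v v)"
proof -
  have "((\<lambda>v. v v* M) ^^ k) v \<bullet> (X *v (((\<lambda>v. v v* M) ^^ k) v)) \<le> v \<bullet> (X *v v)" for k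
  proof (induction k)
    case (Suc k)
    then show ?case
      using X[of "((\<lambda>v. v v* M) ^^ k) v"] by simp
  qed simp
  then show ?thesis
    using LIMSEQ_le_const2[OF tendsto_inner_matrix_iterates[OF M]] by blast
qed

lemma linear_lyapunov: "linear (\<lambda>X. X - M ** X ** transpose M)" for M :: "real^'n^'n"
  by (rule linearI)
    (simp_all add: matrix_add_ldistrib matrix_mult_add_left matrix_mult_scaleR_left
      matrix_mult_scaleR_right scaleR_diff_right)

text \<open>The bilinear form of \<open>X\<close> is invariant under the row iteration, yet tends to
  0 along it. Both arguments are kept, since \<open>X\<close> need not be symmetric.\<close>

lemma Schur_lyapunov_injective:
  fixes M X :: "real^'n^'n"
  assumes M: "Schur M" and X: "X - M ** X ** transpose M = 0"
  shows "X = 0"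
proof -
  have inv: "v \<bullet> (X *v w) = (v v* M) \<bullet> (X *v (w v* M))" for v w
  proof -
    have "X = M ** X ** transpose M"
      using X by simp
    then have "v \<bullet> (X *v w) = v \<bullet> ((M ** X ** transpose M) *v w)"
      by simp
    then show ?thesis
      by (simp only: inner_congruence)
  qed
  have "v \<bullet> (X *v w) = 0" for v w
  proof -
    have "((\<lambda>v. v v* M) ^^ k) v \<bullet> (X *v (((\<lambda>v. v v* M) ^^ k) w)) = v \<bullet> (X *v w)" for k
      by (induction k) (simp_all flip: inv)
    with tendsto_inner_matrix_iterates[OF M, of v X w] show ?thesis
      by (simp add: LIMSEQ_const_iff)
  qed
  then have "X *v w = 0" for w
    by (metis inner_eq_zero_iff)
  then show ?thesis
    by (simp add: matrix_eq)
qed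

text \<open>The description inside \<open>H2_norm\<close>, depending on the closed loop
  alone.\<close>

definition gramian :: "real^'n^'n \<Rightarrow> real^'n^'n" where
  "gramian M = (THE P. M ** P ** transpose M - P + mat 1 = 0)"

text \<open>Existence comes from uniqueness: an injective linear map of a finite-dimensional space
  to itself is surjective, so no series of powers has to be summed.\<close>

lemma gramian_eq:
  assumes M: "Schur M"
  shows "M ** gramian M ** transpose M - gramian M + mat 1 = 0"
  unfolding gramian_def
proof (rule theI')
  have inj: "inj (\<lambda>X. X - M ** X ** transpose M)"
    using Schur_lyapunov_injective[OF M] unfolding linear_injective_0[OF linear_lyapunov] by blast
  then have "surj (\<lambda>X. X - M ** X ** transpose M)"
    by (rule linear_injective_imp_surjective[OF linear_lyapunov]) simp_all
  then obtain P where P: "mat 1 = P - M ** P ** transpose M"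
    by (rule surjE)
  show "\<exists>!P. M ** P ** transpose M - P + mat 1 = 0"
  proof
    show "M ** P ** transpose M - P + mat 1 = 0"
      by (simp add: P)
    show "P' = P" if "M ** P' ** transpose M - P' + mat 1 = 0" for P'
    proof (rule injD[OF inj])
      have "P' - M ** P' ** transpose M = mat 1"
        using that by (simp add: algebra_simps)
      then show "P' - M ** P' ** transpose M = P - M ** P ** transpose M"
        using P by simp
    qed
  qed
qed

lemma gramian_form:
  assumes "Schur M"
  shows "v \<bullet> v + (v v* M) \<bullet> (gramian M *v (v v* M)) = v \<bullet> (gramian M *v v)"
proof -
  have "v \<bullet> ((M ** gramian M ** transpose M - gramian M + mat 1) *v v) = 0"
    by (simp add: gramian_eq[OF assms])
  then show ?thesis
    by (simp add: matrix_vector_mult_diff_rdistrib matrix_vector_mult_add_rdistrib inner_diff_right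
        inner_add_right inner_congruence)
qed

lemma subgramian_gramian:
  assumes M: "Schur M"
  shows "subgramian M (gramian M)"
proof -
  define P where "P = gramian M"
  have P: "M ** P ** transpose M - P + mat 1 = 0"
    using gramian_eq[OF M] by (simp add: P_def)
  have "transpose (M ** P ** transpose M - P + mat 1) = M ** transpose P ** transpose M - transpose P + mat 1"
    by (simp add: transpose_add transpose_diff matrix_transpose_mul matrix_mul_assoc)
  then have P': "M ** transpose P ** transpose M - transpose P + mat 1 = 0"
    using P by (simp add: transpose_zero)
  \<comment> \<open>Symmetry: the transpose solves the same equation, so the difference lies in the
    kernel of the Lyapunov map.\<close>
  have "(transpose P - P) - M ** (transpose P - P) ** transpose M
      = (M ** P ** transpose M - P + mat 1) - (M ** transpose P ** transpose M - transpose P + mat 1)"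
    by (simp add: matrix_mult_diff_right matrix_mult_diff_left)
  then have sym: "transpose P = P"
    using Schur_lyapunov_injective[OF M, of "transpose P - P"] unfolding P P' by simp
  have form: "v \<bullet> v + (v v* M) \<bullet> (P *v (v v* M)) = v \<bullet> (P *v v)" for v
    using gramian_form[OF M] by (simp add: P_def)
  have "0 \<le> v \<bullet> (P *v v)" for v
    by (rule Schur_form_nonneg[OF M]) (use form in \<open>smt (verit) inner_ge_zero\<close>)
  then have "v \<bullet> v \<le> v \<bullet> (P *v v)" for v
    using form by (smt (verit))
  then show ?thesis
    using form sym unfolding subgramian_def P_def by simp
qed

text \<open>Subtracting the Lyapunov equation from the inequality cancels the identity, so the
  difference falls under the comparison principle.\<close>

lemma gramian_le_subgramian:
  assumes "subgramian M P"
  shows "v \<bullet> (gramian M *v v) \<le> v \<bullet> (P *v v)"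
proof -
  have M: "Schur M"
    using assms by (rule subgramian_imp_Schur)
  have diff: "w \<bullet> ((P - gramian M) *v w) = w \<bullet> (P *v w) - w \<bullet> (gramian M *v w)" for w
    by (simp add: matrix_vector_mult_diff_rdistrib inner_diff_right)
  have "0 \<le> v \<bullet> ((P - gramian M) *v v)"
  proof (rule Schur_form_nonneg[OF M])
    fix w
    have "w \<bullet> w + (w v* M) \<bullet> (P *v (w v* M)) \<le> w \<bullet> (P *v w)"
      using assms by (simp add: subgramian_def)
    then show "(w v* M) \<bullet> ((P - gramian M) *v (w v* M)) \<le> w \<bullet> ((P - gramian M) *v w)"
      using gramian_form[OF M, of w] by (simp add: diff)
  qed
  then show ?thesis
    by (simp add: diff)
qed

section \<open>The cost\<close>


lemma trace_mult_lower_bound: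
  fixes S P :: "real^'n^'n"
  assumes S: "transpose S = S" "\<And>v. c * (v \<bullet> v) \<le> v \<bullet> (S *v v)" and P: "pos_semidef P"
  shows "c * trace P \<le> trace (S ** P)"
proof -
  have "pos_semidef (S - c *\<^sub>R mat 1)"
    using S by (simp add: pos_semidef_def transpose_diff transpose_scalar matrix_vector_mult_diff_rdistrib
        inner_diff_right scaleR_matrix_vector_assoc[symmetric])
  from trace_mult_nonneg[OF this P] show ?thesis
    by (simp add: matrix_mult_diff_left trace_sub matrix_mult_scaleR_left trace_scaleR)
qed

text \<open>The forms at \<open>e\<^sub>i + e\<^sub>j\<close> and
  \<open>e\<^sub>i - e\<^sub>j\<close> bound twice the absolute entry by the sum of two diagonal
  entries, each at most the trace.\<close>

lemma pos_semidef_entry_le_trace: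
  assumes P: "pos_semidef P"
  shows "\<bar>P $ i $ j\<bar> \<le> trace P"
proof -
  have sym: "transpose P = P" and psd: "\<And>v. 0 \<le> v \<bullet> (P *v v)"
    using P by (auto simp: pos_semidef_def)
  have entry: "axis i 1 \<bullet> (P *v axis j 1) = P $ i $ j" for i j
    by (simp add: matrix_vector_mul_component inner_axis inner_axis')
  have sym': "P $ i $ j = P $ j $ i"
    using arg_cong[OF sym, of "\<lambda>X. X $ i $ j"] by (simp add: transpose_def)
  have diag: "0 \<le> P $ k $ k" for k
    using psd[of "axis k 1"] by (simp add: entry)
  have "P $ k $ k \<le> trace P" for k
    unfolding trace_def using diag by (intro member_le_sum) auto
  from this[of i] this[of j] show ?thesis
    using psd[of "axis i 1 + 1 *\<^sub>R axis j 1"] psd[of "axis i 1 + (- 1) *\<^sub>R axis j 1"]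
    unfolding quadratic_form_add[OF sym] entry by (auto simp: sym')
qed

lemma norm_matrix_le_sum: "norm X \<le> (\<Sum>i\<in>UNIV. \<Sum>j\<in>UNIV. \<bar>X $ i $ j\<bar>)" for X :: "real^'n^'m"
proof -
  have "norm X \<le> (\<Sum>i\<in>UNIV. norm (X $ i))"
    unfolding norm_vec_def[of X] by (rule L2_set_le_sum) simp
  also have "\<dots> \<le> (\<Sum>i\<in>UNIV. \<Sum>j\<in>UNIV. \<bar>X $ i $ j\<bar>)"
    by (intro sum_mono norm_le_l1_cart)
  finally show ?thesis .
qed

lemma pos_semidef_norm_le_trace:
  fixes P :: "real^'n^'n"
  assumes P: "pos_semidef P"
  shows "norm P \<le> (real CARD('n))\<^sup>2 * trace P"
proof -
  have "(\<Sum>i\<in>UNIV. \<Sum>j\<in>UNIV. \<bar>P $ i $ j\<bar>) \<le> (\<Sum>i\<in>(UNIV::'n set). \<Sum>j\<in>(UNIV::'n set). trace P)"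
    by (intro sum_mono pos_semidef_entry_le_trace[OF P])
  then show ?thesis
    using norm_matrix_le_sum[of P] by (simp add: power2_eq_square mult.assoc)
qed

text \<open>Each diagonal entry of \<open>K P K\<^sup>T\<close> is the form of \<open>P\<close> at a
  row of \<open>K\<close>. This is how domination of the identity by \<open>P\<close> makes the cost
  control the gain.\<close>

lemma trace_congruence_lower_bound:
  fixes K :: "real^'n^'m"
  assumes "\<And>v. v \<bullet> v \<le> v \<bullet> (P *v v)"
  shows "(norm K)\<^sup>2 \<le> trace (K ** P ** transpose K)"
proof -
  have "axis i 1 v* K = K $ i" for i
    by (simp add: vec_eq_iff vector_matrix_mult_def axis_def if_distrib[where f = "\<lambda>x. x * y" for y]
        if_distrib[where f = "\<lambda>x. y * x" for y] cong: if_cong)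
  then have diag: "(K ** P ** transpose K) $ i $ i = K $ i \<bullet> (P *v K $ i)" for i
    using inner_congruence[of "axis i 1" K P "axis i 1"]
    by (simp add: matrix_vector_mul_component inner_axis inner_axis')
  have "(norm K)\<^sup>2 = (\<Sum>i\<in>UNIV. K $ i \<bullet> K $ i)"
    by (simp add: power2_norm_eq_inner inner_vec_def)
  also have "\<dots> \<le> (\<Sum>i\<in>UNIV. (K ** P ** transpose K) $ i $ i)"
    unfolding diag by (intro sum_mono assms)
  finally show ?thesis
    by (simp add: trace_def)
qed

text \<open>Cyclicity of the trace lets the gain enter through \<open>K P K\<^sup>T\<close>, which
  is positive semidefinite whenever \<open>P\<close> is.\<close>

lemma lqr_cost_eq:
  "lqr_cost Q R P K = trace (Q ** P) + trace (R ** (K ** P ** transpose K))"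
proof -
  have "trace (transpose K ** R ** K ** P) = trace (transpose K ** (R ** K ** P))"
    by (simp add: matrix_mul_assoc)
  also have "\<dots> = trace (R ** K ** P ** transpose K)"
    by (rule trace_mul_sym)
  finally show ?thesis
    by (simp add: lqr_cost_def trace_add matrix_mul_assoc)
qed

lemma lqr_cost_scaleR: "lqr_cost Q R (c *\<^sub>R P) K = c * lqr_cost Q R P K"
  by (simp add: lqr_cost_eq matrix_mult_scaleR_left matrix_mult_scaleR_right trace_scaleR
      distrib_left)

lemma pos_def_imp_pos_semidef: "pos_def S \<Longrightarrow> pos_semidef S"
  unfolding pos_def_def pos_semidef_def by (metis inner_zero_left order_le_less)

lemma lqr_cost_mono:
  assumes "pos_def Q" "pos_def R" "pos_semidef (P' - P)"
  shows "lqr_cost Q R P K \<le> lqr_cost Q R P' K"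
proof -
  have "0 \<le> trace (Q ** (P' - P))" "0 \<le> trace (R ** (K ** (P' - P) ** transpose K))"
    using trace_mult_nonneg[OF pos_def_imp_pos_semidef[OF assms(1)] assms(3)]
      trace_mult_nonneg[OF pos_def_imp_pos_semidef[OF assms(2)] pos_semidef_congruence[OF assms(3)]]
    by auto
  then show ?thesis
    by (simp add: lqr_cost_eq matrix_mult_diff_right matrix_mult_diff_left trace_sub)
qed

text \<open>The constant is chosen before \<open>M\<close>, so the same bounds serve the true system
  and every estimated one. Strict positivity is what later allows division by the optimal
  cost.\<close>

lemma lqr_cost_coercive:
  fixes Q :: "real^'n^'n" and R :: "real^'m^'m"
  assumes Q: "pos_def Q" and R: "pos_def R"
  obtains c where "c > 0"
    "\<forall>M P (K :: real^'n^'m). subgramian M P \<longrightarrow>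
      c * norm P \<le> lqr_cost Q R P K \<and> c * (norm K)\<^sup>2 \<le> lqr_cost Q R P K \<and> 0 < lqr_cost Q R P K"
proof -
  obtain q where q: "q > 0" "\<forall>v. q * (v \<bullet> v) \<le> v \<bullet> (Q *v v)"
    by (rule pos_def_lower_bound[OF Q])
  obtain r where r: "r > 0" "\<forall>v. r * (v \<bullet> v) \<le> v \<bullet> (R *v v)"
    by (rule pos_def_lower_bound[OF R])
  define N where "N = (real CARD('n))\<^sup>2"
  \<comment> \<open>\<open>q\<close> and \<open>r\<close> bound the forms of \<open>Q\<close> and
    \<open>R\<close> from below; \<open>N\<close> is the price of bounding the norm of
    \<open>P\<close> by its trace.\<close>
  define c where "c = min (q / N) r"
  have N: "N > 0"
    by (simp add: N_def)
  show thesis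
  proof (rule that)
    show "c > 0"
      using q r N by (simp add: c_def)
    show "\<forall>M P (K :: real^'n^'m). subgramian M P \<longrightarrow>
      c * norm P \<le> lqr_cost Q R P K \<and> c * (norm K)\<^sup>2 \<le> lqr_cost Q R P K \<and> 0 < lqr_cost Q R P K"
    proof (intro allI impI)
      fix M P :: "real^'n^'n" and K :: "real^'n^'m"
      assume "subgramian M P"
      then have P: "pos_semidef P" and lower: "\<And>v. v \<bullet> v \<le> v \<bullet> (P *v v)"
        using subgramian_pos_semidef unfolding subgramian_def by blast+
      have "P $ i $ i \<ge> 1" for i
        using lower[of "axis i 1"] by (simp add: matrix_vector_mul_component inner_axis inner_axis')
      then have "trace P > 0"
        unfolding trace_def by (intro sum_pos) (auto intro: less_le_trans[OF zero_less_one])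
      then have pos: "0 < q * trace P"
        using q by simp
      have 1: "q * trace P \<le> trace (Q ** P)"
        using Q q P by (intro trace_mult_lower_bound) (auto simp: pos_def_def)
      have "r * (norm K)\<^sup>2 \<le> r * trace (K ** P ** transpose K)"
        using r by (intro mult_left_mono trace_congruence_lower_bound lower) auto
      also have "\<dots> \<le> trace (R ** (K ** P ** transpose K))"
        using R r P by (intro trace_mult_lower_bound pos_semidef_congruence) (auto simp: pos_def_def)
      finally have 2: "r * (norm K)\<^sup>2 \<le> trace (R ** (K ** P ** transpose K))" .
      have "c * norm P \<le> (q / N) * norm P"
        by (intro mult_right_mono) (auto simp: c_def)
      also have "\<dots> \<le> q * trace P"
        using pos_semidef_norm_le_trace[OF P] q N by (simp add: N_def field_simps)
      finally have 3: "c * norm P \<le> q * trace P" .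
      have 4: "c * (norm K)\<^sup>2 \<le> r * (norm K)\<^sup>2"
        by (intro mult_right_mono) (auto simp: c_def)
      have "0 \<le> r * (norm K)\<^sup>2"
        using r by simp
      then show "c * norm P \<le> lqr_cost Q R P K \<and> c * (norm K)\<^sup>2 \<le> lqr_cost Q R P K \<and> 0 < lqr_cost Q R P K"
        using 1 2 3 4 pos unfolding lqr_cost_eq by linarith
    qed
  qed
qed

section \<open>Continuity and the existence of optimal pairs\<close>

lemma continuous_on_matrix_mult [continuous_intros]:
  fixes f :: "'a::topological_space \<Rightarrow> real^'n^'m" and g :: "'a \<Rightarrow> real^'k^'n"
  assumes "continuous_on S f" "continuous_on S g"
  shows "continuous_on S (\<lambda>x. f x ** g x)"
  unfolding matrix_matrix_mult_def by (intro continuous_intros assms)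

lemma continuous_on_matrix_vector_mult [continuous_intros]:
  fixes f :: "'a::topological_space \<Rightarrow> real^'n^'m"
  assumes "continuous_on S f" "continuous_on S g"
  shows "continuous_on S (\<lambda>x. f x *v g x)"
  unfolding matrix_vector_mult_def by (intro continuous_intros assms)

lemma continuous_on_vector_matrix_mult [continuous_intros]:
  fixes f :: "'a::topological_space \<Rightarrow> real^'n^'m"
  assumes "continuous_on S f" "continuous_on S g"
  shows "continuous_on S (\<lambda>x. g x v* f x)"
  unfolding vector_matrix_mult_def by (intro continuous_intros assms)

lemma continuous_on_transpose [continuous_intros]:
  fixes f :: "'a::topological_space \<Rightarrow> real^'n^'m"
  assumes "continuous_on S f"
  shows "continuous_on S (\<lambda>x. transpose (f x))"
  unfolding transpose_def by (intro continuous_intros assms)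

lemma continuous_on_trace [continuous_intros]:
  fixes f :: "'a::topological_space \<Rightarrow> real^'n^'n"
  assumes "continuous_on S f"
  shows "continuous_on S (\<lambda>x. trace (f x))"
  unfolding trace_def by (intro continuous_intros assms)

abbreviation lqr_optimal where
  "lqr_optimal A B Q R \<equiv> is_arg_min (\<lambda>(P, K). lqr_cost Q R P K) (\<lambda>(P, K). subgramian (A + B ** K) P)"

lemma lqr_optimal_iff:
  "lqr_optimal A B Q R (P, K) \<longleftrightarrow> subgramian (A + B ** K) P \<and>
    (\<forall>P' K'. subgramian (A + B ** K') P' \<longrightarrow> lqr_cost Q R P K \<le> lqr_cost Q R P' K')"
  by (auto simp: is_arg_min_linorder)

text \<open>A sublevel set of the cost on the feasible pairs is compact: coercivity bounds it, and
  it is closed because feasibility consists of equations and nonstrict inequalities. A direct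
  minimisation over \<open>K\<close> would face the open condition \<open>Schur\<close>.\<close>

lemma ex_lqr_optimal:
  fixes A :: "real^'n^'n" and B :: "real^'m^'n"
  assumes Q: "pos_def Q" and R: "pos_def R" and feas: "subgramian (A + B ** K0) P0"
  obtains P K where "lqr_optimal A B Q R (P, K)"
proof -
  define J where "J = lqr_cost Q R P0 K0"
  define S where "S = {x :: (real^'n^'n) \<times> (real^'n^'m).
    subgramian (A + B ** snd x) (fst x) \<and> lqr_cost Q R (fst x) (snd x) \<le> J}"
  obtain c where c: "c > 0" and coercive: "\<forall>M P (K :: real^'n^'m). subgramian M P \<longrightarrow>
      c * norm P \<le> lqr_cost Q R P K \<and>
      c * (norm K)\<^sup>2 \<le> lqr_cost Q R P K \<and> 0 < lqr_cost Q R P K"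
    by (rule lqr_cost_coercive[OF Q R])
  have "bounded S"
  proof (rule bounded_subset)
    show "bounded (cball 0 (J / c) \<times> cball 0 (sqrt (J / c)) :: ((real^'n^'n) \<times> (real^'n^'m)) set)"
      by (intro bounded_Times bounded_cball)
    show "S \<subseteq> cball 0 (J / c) \<times> cball 0 (sqrt (J / c))"
    proof
      fix x assume x: "x \<in> S"
      then have "c * norm (fst x) \<le> lqr_cost Q R (fst x) (snd x)"
          "c * (norm (snd x))\<^sup>2 \<le> lqr_cost Q R (fst x) (snd x)"
        using coercive by (auto simp: S_def)
      then have "norm (fst x) \<le> J / c" "(norm (snd x))\<^sup>2 \<le> J / c"
        using x c by (auto simp: S_def field_simps)
      then show "x \<in> cball 0 (J / c) \<times> cball 0 (sqrt (J / c))"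
        by (auto simp: mem_Times_iff real_le_rsqrt)
    qed
  qed
  moreover have "closed S"
    unfolding S_def subgramian_def lqr_cost_def
    by (intro closed_Collect_conj closed_Collect_all closed_Collect_le closed_Collect_eq continuous_intros)
  ultimately have "compact S"
    by (simp add: compact_eq_bounded_closed)
  moreover have "S \<noteq> {}"
    using feas by (auto simp: S_def J_def)
  moreover have "continuous_on S (\<lambda>x. lqr_cost Q R (fst x) (snd x))"
    unfolding lqr_cost_def by (intro continuous_intros)
  ultimately have "\<exists>x\<in>S. \<forall>y\<in>S. lqr_cost Q R (fst x) (snd x) \<le> lqr_cost Q R (fst y) (snd y)"
    by (rule continuous_attains_inf)
  then obtain P K where opt: "(P, K) \<in> S"
      "\<forall>y\<in>S. lqr_cost Q R P K \<le> lqr_cost Q R (fst y) (snd y)"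
    by auto
  have "lqr_cost Q R P K \<le> lqr_cost Q R P' K'" if "subgramian (A + B ** K') P'" for P' K'
  proof (cases "lqr_cost Q R P' K' \<le> J")
    case True
    then have "(P', K') \<in> S"
      using that by (simp add: S_def)
    then show ?thesis
      using opt(2) by fastforce
  next
    case False
    then show ?thesis
      using opt(1) by (simp add: S_def)
  qed
  moreover have "subgramian (A + B ** K) P"
    using opt(1) by (simp add: S_def)
  ultimately have "lqr_optimal A B Q R (P, K)"
    by (simp add: lqr_optimal_iff)
  then show thesis
    by (rule that)
qed

section \<open>The optimal gain and its robustness\<close>


text \<open>The decomposition of second moments about the mean: the cross terms contain
  \<open>E1 P1 + E2 P2\<close> or its transpose and cancel. It serves both the closed loops, with
  \<open>G = B\<close>, and the gains themselves, with \<open>G = I\<close>.\<close>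

lemma conjugate_deviations:
  fixes X :: "real^'n^'k" and G :: "real^'m^'k" and E1 E2 :: "real^'n^'m"
  assumes P1: "transpose P1 = P1" and P2: "transpose P2 = P2" and E: "E1 ** P1 + E2 ** P2 = 0"
  shows "(X + G ** E1) ** P1 ** transpose (X + G ** E1) + (X + G ** E2) ** P2 ** transpose (X + G ** E2)
    = X ** (P1 + P2) ** transpose X
      + G ** (E1 ** P1 ** transpose E1 + E2 ** P2 ** transpose E2) ** transpose G"
proof -
  have expand: "(X + G ** E) ** P ** transpose (X + G ** E) = X ** P ** transpose X
      + X ** transpose (E ** P) ** transpose G + G ** (E ** P) ** transpose X
      + G ** (E ** P ** transpose E) ** transpose G"
    if "transpose P = P" for E :: "real^'n^'m" and P
    by (simp add: transpose_add matrix_transpose_mul matrix_mult_add_left matrix_add_ldistrib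
        matrix_mul_assoc that)
  have E1: "E1 ** P1 = 0 - E2 ** P2"
    using E by (simp add: eq_neg_iff_add_eq_0)
  show ?thesis
    unfolding expand[OF P1] expand[OF P2] unfolding E1
    by (simp only: transpose_diff transpose_zero matrix_mult_diff_left matrix_mult_diff_right
        matrix_mult_add_left matrix_add_ldistrib matrix_mul_assoc times0_left times0_right) simp
qed

text \<open>The gain interpolates in the variables \<open>(P, K P)\<close>, in which the problem is convex;
  the gap in the matrix inequality and in the cost is the covariance of the two deviations.\<close>

lemma lqr_midpoint:
  fixes A :: "real^'n^'n" and B :: "real^'m^'n"
  assumes Q: "pos_def Q" and R: "pos_def R"
    and sub1: "subgramian (A + B ** K1) P1" and sub2: "subgramian (A + B ** K2) P2"
    and "K1 \<noteq> K2"
  obtains P K where "subgramian (A + B ** K) P"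
    "2 * lqr_cost Q R P K < lqr_cost Q R P1 K1 + lqr_cost Q R P2 K2"
proof -
  have sym1: "transpose P1 = P1" and sym2: "transpose P2 = P2"
    using sub1 sub2 by (simp_all add: subgramian_def)
  have lower: "v \<bullet> v \<le> v \<bullet> (P1 *v v)" "v \<bullet> v \<le> v \<bullet> (P2 *v v)" for v
    using sub1 sub2 by (simp_all add: subgramian_def)
  define P where "P = (1 / 2) *\<^sub>R (P1 + P2)"
  have P12: "P1 + P2 = 2 *\<^sub>R P"
    by (simp add: P_def)
  have Pv: "v \<bullet> (P *v w) = (v \<bullet> (P1 *v w) + v \<bullet> (P2 *v w)) / 2" for v w
    by (simp add: P_def matrix_vector_mult_add_rdistrib inner_add_right
        scaleR_matrix_vector_assoc[symmetric])
  have lowerP: "v \<bullet> v \<le> v \<bullet> (P *v v)" for v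
    using lower[of v] by (simp add: Pv)
  \<comment> \<open>Invertibility of the averaged \<open>P\<close> is what allows a gain to be
    recovered from the averaged product.\<close>
  then have "\<exists>W. W ** P = mat 1"
    unfolding matrix_left_invertible_ker
    by (metis inner_eq_zero_iff inner_ge_zero inner_zero_right order_antisym)
  then obtain W where inv: "W ** P = mat 1"
    by blast
  define K where "K = ((1 / 2) *\<^sub>R (K1 ** P1 + K2 ** P2)) ** W"
  have KP: "K ** P = (1 / 2) *\<^sub>R (K1 ** P1 + K2 ** P2)"
    by (simp add: K_def inv flip: matrix_mul_assoc)
  define E1 where "E1 = K1 - K"
  define E2 where "E2 = K2 - K"
  have E: "E1 ** P1 + E2 ** P2 = 0"
  proof -
    have "E1 ** P1 + E2 ** P2 = K1 ** P1 + K2 ** P2 - K ** (P1 + P2)"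
      by (simp add: E1_def E2_def matrix_mult_diff_left matrix_add_ldistrib)
    also have "\<dots> = 0"
      unfolding P12 matrix_mult_scaleR_right KP by simp
    finally show ?thesis .
  qed
  define D where "D = E1 ** P1 ** transpose E1 + E2 ** P2 ** transpose E2"
  have psd: "pos_semidef P1" "pos_semidef P2"
    using sub1 sub2 by (auto intro: subgramian_pos_semidef)
  then have "pos_semidef (E1 ** P1 ** transpose E1)" "pos_semidef (E2 ** P2 ** transpose E2)"
    by (simp_all add: pos_semidef_congruence)
  then have D: "pos_semidef D"
    unfolding D_def pos_semidef_def
    by (simp add: transpose_add matrix_vector_mult_add_rdistrib inner_add_right)
  define M where "M = A + B ** K"
  have "A + B ** K1 = M + B ** E1" "A + B ** K2 = M + B ** E2"
    by (simp_all add: M_def E1_def E2_def matrix_mult_diff_right)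
  note M12 = this
  have "subgramian M P"
    unfolding subgramian_def
  proof (intro conjI allI)
    show "transpose P = P"
      by (simp add: P_def transpose_scalar transpose_add sym1 sym2)
    show "v \<bullet> v \<le> v \<bullet> (P *v v)" for v
      by (rule lowerP)
    fix v
    have "v \<bullet> (((M + B ** E1) ** P1 ** transpose (M + B ** E1)
        + (M + B ** E2) ** P2 ** transpose (M + B ** E2)) *v v)
      = 2 * (v \<bullet> ((M ** P ** transpose M) *v v)) + v \<bullet> ((B ** D ** transpose B) *v v)"
      unfolding conjugate_deviations[OF sym1 sym2 E] P12 D_def[symmetric]
      by (simp add: matrix_mult_scaleR_left matrix_mult_scaleR_right matrix_vector_mult_add_rdistrib
          inner_add_right scaleR_matrix_vector_assoc[symmetric])
    moreover have "0 \<le> v \<bullet> ((B ** D ** transpose B) *v v)"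
      using pos_semidef_congruence[OF D] unfolding pos_semidef_def by blast
    moreover have "v \<bullet> v + v \<bullet> (((M + B ** E1) ** P1 ** transpose (M + B ** E1)) *v v) \<le> v \<bullet> (P1 *v v)"
      "v \<bullet> v + v \<bullet> (((M + B ** E2) ** P2 ** transpose (M + B ** E2)) *v v) \<le> v \<bullet> (P2 *v v)"
      using sub1 sub2 unfolding M12 inner_congruence by (simp_all add: subgramian_def)
    ultimately have "2 * (v \<bullet> v) + 2 * (v \<bullet> ((M ** P ** transpose M) *v v)) \<le> v \<bullet> (P1 *v v) + v \<bullet> (P2 *v v)"
      unfolding matrix_vector_mult_add_rdistrib[of "(M + B ** E1) ** P1 ** transpose (M + B ** E1)"]
        inner_add_right by linarith
    then show "v \<bullet> v + (v v* M) \<bullet> (P *v (v v* M)) \<le> v \<bullet> (P *v v)"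
      unfolding inner_congruence Pv[of v v] by (simp add: field_simps)
  qed
  moreover have "2 * lqr_cost Q R P K < lqr_cost Q R P1 K1 + lqr_cost Q R P2 K2"
  proof -
    have "K1 = K + mat 1 ** E1" "K2 = K + mat 1 ** E2"
      by (simp_all add: E1_def E2_def)
    then have "K1 ** P1 ** transpose K1 + K2 ** P2 ** transpose K2
        = K ** (P1 + P2) ** transpose K + D"
      using conjugate_deviations[OF sym1 sym2 E, of K "mat 1"] unfolding D_def by simp
    then have "K1 ** P1 ** transpose K1 + K2 ** P2 ** transpose K2
        = 2 *\<^sub>R (K ** P ** transpose K) + D"
      unfolding P12 by (simp add: matrix_mult_scaleR_left matrix_mult_scaleR_right)
    then have "trace (R ** (K1 ** P1 ** transpose K1)) + trace (R ** (K2 ** P2 ** transpose K2))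
        = 2 * trace (R ** (K ** P ** transpose K)) + trace (R ** D)"
      by (metis matrix_add_ldistrib matrix_mult_scaleR_right trace_add trace_scaleR)
    moreover have "trace (Q ** P1) + trace (Q ** P2) = 2 * trace (Q ** P)"
      by (metis P12 matrix_add_ldistrib matrix_mult_scaleR_right trace_add trace_scaleR)
    \<comment> \<open>The source of strictness: distinct gains cannot both equal \<open>K\<close>,
      and a nonzero deviation has positive covariance because \<open>P1\<close> and
      \<open>P2\<close> dominate the identity.\<close>
    moreover have "0 < trace (R ** D)"
    proof -
      obtain r where r: "r > 0" "\<forall>v. r * (v \<bullet> v) \<le> v \<bullet> (R *v v)"
        by (rule pos_def_lower_bound[OF R])
      have "E1 \<noteq> 0 \<or> E2 \<noteq> 0"
        using \<open>K1 \<noteq> K2\<close> by (auto simp: E1_def E2_def)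
      then have "0 < (norm E1)\<^sup>2 + (norm E2)\<^sup>2"
        by (auto simp: sum_power2_gt_zero_iff)
      also have "\<dots> \<le> trace D"
        using trace_congruence_lower_bound[of P1 E1] trace_congruence_lower_bound[of P2 E2] lower
        by (simp add: D_def trace_add)
      finally have "0 < r * trace D"
        using r by simp
      also have "\<dots> \<le> trace (R ** D)"
        using R r D by (intro trace_mult_lower_bound) (auto simp: pos_def_def)
      finally show ?thesis .
    qed
    ultimately show ?thesis
      by (simp add: lqr_cost_eq)
  qed
  ultimately show thesis
    using that unfolding M_def by blast
qed

lemma lqr_optimal_gain_unique:
  assumes "pos_def Q" "pos_def R" "lqr_optimal A B Q R (P1, K1)" "lqr_optimal A B Q R (P2, K2)"
  shows "K1 = K2"
proof (rule ccontr)
  assume "K1 \<noteq> K2"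
  have sub: "subgramian (A + B ** K1) P1" "subgramian (A + B ** K2) P2"
    using assms(3,4) by (simp_all add: lqr_optimal_iff)
  obtain P K where PK: "subgramian (A + B ** K) P"
    "2 * lqr_cost Q R P K < lqr_cost Q R P1 K1 + lqr_cost Q R P2 K2"
    by (rule lqr_midpoint[OF assms(1,2) sub \<open>K1 \<noteq> K2\<close>])
  have "lqr_cost Q R P1 K1 \<le> lqr_cost Q R P K" "lqr_cost Q R P2 K2 \<le> lqr_cost Q R P K"
    using assms(3,4) PK(1) unfolding lqr_optimal_iff by blast+
  then show False
    using PK(2) by linarith
qed

section \<open>The norm of the closed loop and the optimal gain\<close>

lemma H2_norm_eq: "H2_norm A B Q R K = sqrt (lqr_cost Q R (gramian (A + B ** K)) K)"
  by (simp add: H2_norm_def gramian_def lyapunov_def)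

lemma lqr_cost_pos:
  assumes "pos_def Q" "pos_def R" "subgramian M P"
  shows "0 < lqr_cost Q R P K"
proof -
  obtain c where "c > 0" and c: "\<forall>M P K. subgramian M P \<longrightarrow>
      c * norm P \<le> lqr_cost Q R P K \<and> c * (norm K)\<^sup>2 \<le> lqr_cost Q R P K \<and> 0 < lqr_cost Q R P K"
    by (rule lqr_cost_coercive[OF assms(1,2)])
  show ?thesis
    using c assms(3) by blast
qed

lemma lqr_cost_gramian_le:
  assumes "pos_def Q" "pos_def R" "subgramian (A + B ** K) P"
  shows "lqr_cost Q R (gramian (A + B ** K)) K \<le> lqr_cost Q R P K"
proof (rule lqr_cost_mono[OF assms(1,2)])
  have "transpose (gramian (A + B ** K)) = gramian (A + B ** K)" "transpose P = P"
    using subgramian_gramian[OF subgramian_imp_Schur[OF assms(3)]] assms(3)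
    by (simp_all add: subgramian_def)
  then show "pos_semidef (P - gramian (A + B ** K))"
    using gramian_le_subgramian[OF assms(3)]
    by (simp add: pos_semidef_def transpose_diff matrix_vector_mult_diff_rdistrib inner_diff_right)
qed

lemma H2_norm_squared:
  assumes "pos_def Q" "pos_def R" "Schur (A + B ** K)"
  shows "(H2_norm A B Q R K)\<^sup>2 = lqr_cost Q R (gramian (A + B ** K)) K"
  using lqr_cost_pos[OF assms(1,2) subgramian_gramian[OF assms(3)], of K] by (simp add: H2_norm_eq)

text \<open>The Gramian of the gain \<open>K\<close> is feasible and costs no more than
  \<open>P\<close>, so the optimal pair attains the cost of its Gramian. The definite description is
  then resolved by uniqueness of the optimal gain.\<close>

lemma H2_norm_optimal_gain:
  assumes Q: "pos_def Q" and R: "pos_def R" and opt: "lqr_optimal A B Q R (P, K)"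
  shows "(H2_norm A B Q R (optimal_gain A B Q R))\<^sup>2 = lqr_cost Q R P K"
proof -
  define J where "J = (\<lambda>K. lqr_cost Q R (gramian (A + B ** K)) K)"
  have sub: "subgramian (A + B ** K) P"
    and le: "\<And>P' K'. subgramian (A + B ** K') P' \<Longrightarrow> lqr_cost Q R P K \<le> lqr_cost Q R P' K'"
    using opt by (auto simp: lqr_optimal_iff)
  have K: "Schur (A + B ** K)"
    using sub by (rule subgramian_imp_Schur)
  have JK: "J K = lqr_cost Q R P K"
    using lqr_cost_gramian_le[OF Q R sub] le[OF subgramian_gramian[OF K]] by (simp add: J_def)
  have min: "J K \<le> J K'" if "Schur (A + B ** K')" for K'
    unfolding JK using le[OF subgramian_gramian[OF that]] by (simp add: J_def)
  have H2: "H2_norm A B Q R = (\<lambda>K. sqrt (J K))"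
    by (simp add: fun_eq_iff H2_norm_eq J_def)
  have "optimal_gain A B Q R = K"
    unfolding optimal_gain_def
  proof (rule the_equality)
    show "is_arg_min (H2_norm A B Q R) (\<lambda>K. Schur (A + B ** K)) K"
      using K min by (simp add: is_arg_min_linorder H2)
    fix K' assume "is_arg_min (H2_norm A B Q R) (\<lambda>K. Schur (A + B ** K)) K'"
    then have K': "Schur (A + B ** K')" "J K' \<le> J K"
      using K by (auto simp: is_arg_min_linorder H2)
    \<comment> \<open>A competing minimiser of the norm, paired with its own Gramian, is optimal
      among pairs, where uniqueness is available.\<close>
    have "lqr_optimal A B Q R (gramian (A + B ** K'), K')"
      unfolding lqr_optimal_iff
    proof (intro conjI allI impI)
      show "subgramian (A + B ** K') (gramian (A + B ** K'))"
        by (rule subgramian_gramian[OF K'(1)])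
      fix P'' K'' assume "subgramian (A + B ** K'') P''"
      then have "lqr_cost Q R P K \<le> lqr_cost Q R P'' K''"
        by (rule le)
      then show "lqr_cost Q R (gramian (A + B ** K')) K' \<le> lqr_cost Q R P'' K''"
        using K'(2) JK by (simp add: J_def)
    qed
    then show "K' = K"
      using lqr_optimal_gain_unique[OF Q R _ opt] by blast
  qed
  then show ?thesis
    using H2_norm_squared[OF Q R K] JK by (simp add: J_def)
qed

section \<open>Robustness of certainty equivalence\<close>

lemma norm_matrix_vector_mult_le:
  fixes X :: "real^'n^'m"
  shows "norm (X *v v) \<le> norm X * norm v"
proof (rule power2_le_imp_le)
  have "(norm (X *v v))\<^sup>2 = (\<Sum>i\<in>UNIV. (X $ i \<bullet> v)\<^sup>2)"
    unfolding power2_norm_eq_inner inner_vec_def[of "X *v v"]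
    by (simp add: matrix_vector_mul_component power2_eq_square)
  also have "\<dots> \<le> (\<Sum>i\<in>UNIV. (X $ i \<bullet> X $ i) * (v \<bullet> v))"
    by (intro sum_mono Cauchy_Schwarz_ineq)
  also have "\<dots> = (norm X * norm v)\<^sup>2"
    by (simp add: power_mult_distrib power2_norm_eq_inner inner_vec_def[of X] sum_distrib_right)
  finally show "(norm (X *v v))\<^sup>2 \<le> (norm X * norm v)\<^sup>2" .
qed simp

lemma abs_quadratic_form_le: "\<bar>v \<bullet> (X *v v)\<bar> \<le> norm X * (v \<bullet> v)" for X :: "real^'n^'n"
proof -
  have "\<bar>v \<bullet> (X *v v)\<bar> \<le> norm v * (norm X * norm v)"
    by (rule order_trans[OF Cauchy_Schwarz_ineq2])
      (intro mult_left_mono norm_matrix_vector_mult_le norm_ge_zero)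
  then show ?thesis
    by (simp add: power2_norm_eq_inner[symmetric] power2_eq_square mult_ac)
qed

text \<open>Uniform continuity on a compact set makes \<delta> independent of \<open>P\<close> and
  \<open>K\<close>. Both points that are compared carry the same \<open>P\<close> and
  \<open>K\<close>, so their distance is the model error alone.\<close>

lemma closed_loop_perturbation:
  fixes A :: "real^'n^'n" and B :: "real^'m^'n"
  assumes "\<eta> > 0"
  obtains \<delta> where "\<delta> > 0"
    "\<forall>A' B' P K v. norm (A' - A) \<le> \<delta> \<and> norm (B' - B) \<le> \<delta> \<and> norm P \<le> C \<and> norm K \<le> C \<longrightarrow>
      \<bar>(v v* (A' + B' ** K)) \<bullet> (P *v (v v* (A' + B' ** K)))
        - (v v* (A + B ** K)) \<bullet> (P *v (v v* (A + B ** K)))\<bar> \<le> \<eta> * (v \<bullet> v)"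
proof -
  define g where "g = (\<lambda>(A' :: real^'n^'n, B' :: real^'m^'n, P, K :: real^'n^'m).
    (A' + B' ** K) ** P ** transpose (A' + B' ** K))"
  define S where "S = cball A 1 \<times> cball B 1 \<times> cball (0 :: real^'n^'n) C \<times> cball (0 :: real^'n^'m) C"
  have "continuous_on S g"
    unfolding g_def case_prod_beta by (intro continuous_intros)
  moreover have "compact S"
    unfolding S_def by (intro compact_Times compact_cball)
  ultimately have "uniformly_continuous_on S g"
    by (rule compact_uniformly_continuous)
  then obtain d where d: "d > 0" "\<forall>x\<in>S. \<forall>y\<in>S. dist y x < d \<longrightarrow> dist (g y) (g x) < \<eta>"
    using assms unfolding uniformly_continuous_on_def by blast
  show thesis
  proof (rule that)
    \<comment> \<open>The 1 keeps the perturbed matrices in the compact set; two errors of at most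
      \<open>d / 4\<close> add up to less than \<open>d\<close>.\<close>
    show "min 1 (d / 4) > 0"
      using d by simp
    show "\<forall>A' B' P K v. norm (A' - A) \<le> min 1 (d / 4) \<and> norm (B' - B) \<le> min 1 (d / 4)
        \<and> norm P \<le> C \<and> norm K \<le> C \<longrightarrow>
      \<bar>(v v* (A' + B' ** K)) \<bullet> (P *v (v v* (A' + B' ** K)))
        - (v v* (A + B ** K)) \<bullet> (P *v (v v* (A + B ** K)))\<bar> \<le> \<eta> * (v \<bullet> v)"
    proof (intro allI impI, elim conjE)
      fix A' :: "real^'n^'n" and B' :: "real^'m^'n" and P :: "real^'n^'n" and K :: "real^'n^'m"
        and v :: "real^'n"
      assume A': "norm (A' - A) \<le> min 1 (d / 4)" and B': "norm (B' - B) \<le> min 1 (d / 4)"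
        and P: "norm P \<le> C" and K: "norm K \<le> C"
      have "dist (A', B', P, K) (A, B, P, K) \<le> norm (A' - A) + norm (B' - B)"
        unfolding dist_norm[symmetric] by (simp add: dist_Pair_Pair sqrt_sum_squares_le_sum)
      also have "\<dots> < d"
        using A' B' d by simp
      finally have "dist (g (A', B', P, K)) (g (A, B, P, K)) < \<eta>"
      proof -
        have "(A', B', P, K) \<in> S" "(A, B, P, K) \<in> S"
          using A' B' P K by (auto simp: S_def dist_norm norm_minus_commute)
        then show "dist (A', B', P, K) (A, B, P, K) < d \<Longrightarrow> ?thesis"
          using d by blast
      qed
      then have *: "norm (g (A', B', P, K) - g (A, B, P, K)) \<le> \<eta>"
        by (simp add: dist_norm)
      have "\<bar>v \<bullet> ((g (A', B', P, K) - g (A, B, P, K)) *v v)\<bar> \<le> \<eta> * (v \<bullet> v)"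
        by (rule order_trans[OF abs_quadratic_form_le mult_right_mono[OF *]]) simp
      then show "\<bar>(v v* (A' + B' ** K)) \<bullet> (P *v (v v* (A' + B' ** K)))
        - (v v* (A + B ** K)) \<bullet> (P *v (v v* (A + B ** K)))\<bar> \<le> \<eta> * (v \<bullet> v)"
        by (simp add: g_def matrix_vector_mult_diff_rdistrib inner_diff_right inner_congruence)
    qed
  qed
qed

text \<open>Apart from the identity, the Lyapunov inequality is homogeneous in \<open>P\<close>. The
  perturbation leaves \<open>1 - \<eta>\<close> times the identity, and the scaling restores the
  rest; as the factor is at least 1, the lower bound on \<open>P\<close> survives.\<close>

lemma subgramian_rescale:
  assumes "subgramian M P" and "0 < \<eta>" "\<eta> < 1"
    and pert: "\<And>v. \<bar>(v v* M') \<bullet> (P *v (v v* M')) - (v v* M) \<bullet> (P *v (v v* M))\<bar> \<le> \<eta> * (v \<bullet> v)"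
  shows "subgramian M' ((1 / (1 - \<eta>)) *\<^sub>R P)"
proof -
  define c where "c = 1 / (1 - \<eta>)"
  have c: "c \<ge> 1" "c * (1 - \<eta>) = 1"
    using assms(2,3) by (simp_all add: c_def field_simps)
  have sym: "transpose P = P"
    and lower: "\<And>v. v \<bullet> v \<le> v \<bullet> (P *v v)"
    and ineq: "\<And>v. v \<bullet> v + (v v* M) \<bullet> (P *v (v v* M)) \<le> v \<bullet> (P *v v)"
    using assms(1) by (simp_all add: subgramian_def)
  have form: "v \<bullet> ((c *\<^sub>R P) *v v) = c * (v \<bullet> (P *v v))" for v
    by (simp add: scaleR_matrix_vector_assoc[symmetric])
  have "v \<bullet> v \<le> c * (v \<bullet> (P *v v))" for v
    using mult_mono[of 1 c "v \<bullet> v" "v \<bullet> (P *v v)"] lower[of v] c by simp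
  moreover have "v \<bullet> v + c * ((v v* M') \<bullet> (P *v (v v* M'))) \<le> c * (v \<bullet> (P *v v))" for v
  proof -
    have "(1 - \<eta>) * (v \<bullet> v) + (v v* M') \<bullet> (P *v (v v* M')) \<le> v \<bullet> (P *v v)"
      using pert[of v] ineq[of v] by (simp add: algebra_simps)
    then have "c * ((1 - \<eta>) * (v \<bullet> v) + (v v* M') \<bullet> (P *v (v v* M'))) \<le> c * (v \<bullet> (P *v v))"
      using c by (intro mult_left_mono) auto
    then show ?thesis
      using c(2) by (simp add: distrib_left mult.assoc[symmetric])
  qed
  ultimately show ?thesis
    using sym unfolding subgramian_def form c_def[symmetric] by (simp add: transpose_scalar)
qed

lemma certainty_equivalence_suboptimality:
  fixes A :: "real^'n^'n" and B :: "real^'m^'n"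
  assumes stab: "stabilizable A B" and Q: "pos_def Q" and R: "pos_def R" and "\<epsilon> > 0"
  obtains \<delta> where "\<delta> > 0"
    "\<forall>A' B'. norm (A' - A) \<le> \<delta> \<and> norm (B' - B) \<le> \<delta> \<longrightarrow>
      (\<exists>P K. lqr_optimal A' B' Q R (P, K)) \<and>
      (\<forall>P K. lqr_optimal A' B' Q R (P, K) \<longrightarrow> Schur (A + B ** K) \<and>
        ((H2_norm A B Q R K)\<^sup>2 - (H2_norm A B Q R (optimal_gain A B Q R))\<^sup>2)
          / (H2_norm A B Q R (optimal_gain A B Q R))\<^sup>2 \<le> \<epsilon>)"
proof -
  obtain K0 where "Schur (A + B ** K0)"
    using stab unfolding stabilizable_def by blast
  then have "subgramian (A + B ** K0) (gramian (A + B ** K0))"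
    by (rule subgramian_gramian)
  then obtain Ps Ks where opt: "lqr_optimal A B Q R (Ps, Ks)"
    by (rule ex_lqr_optimal[OF Q R])
  then have sub: "subgramian (A + B ** Ks) Ps"
    by (simp add: lqr_optimal_iff)
  define J where "J = lqr_cost Q R Ps Ks"
  have J: "J > 0"
    unfolding J_def by (rule lqr_cost_pos[OF Q R sub])
  obtain c where c: "c > 0" and coercive: "\<forall>M P (K :: real^'n^'m). subgramian M P \<longrightarrow>
      c * norm P \<le> lqr_cost Q R P K \<and> c * (norm K)\<^sup>2 \<le> lqr_cost Q R P K \<and> 0 < lqr_cost Q R P K"
    by (rule lqr_cost_coercive[OF Q R])
  \<comment> \<open>The level \<open>2 * J\<close> admits the true optimum and, since
    \<open>1 / (1 - \<eta>) \<le> 2\<close>, the estimated one. The two bounds are those for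
    \<open>P\<close> and for \<open>K\<close>.\<close>
  define C where "C = max (2 * J / c) (sqrt (2 * J / c))"
  have bound: "norm P \<le> C \<and> norm K \<le> C" if "subgramian M P" "lqr_cost Q R P K \<le> 2 * J"
    for M P and K :: "real^'n^'m"
  proof -
    have "c * norm P \<le> 2 * J" "c * (norm K)\<^sup>2 \<le> 2 * J"
      using coercive that by (meson order_trans)+
    then have "norm P \<le> 2 * J / c" "(norm K)\<^sup>2 \<le> 2 * J / c"
      using c by (simp_all add: field_simps)
    then show ?thesis
      by (auto simp: C_def le_max_iff_disj real_le_rsqrt)
  qed
  \<comment> \<open>Chosen so that \<open>(1 + \<epsilon>) * (1 - 2 * \<eta>) = 1\<close>; as
    \<open>(1 - \<eta>)\<^sup>2 \<ge> 1 - 2 * \<eta>\<close>, two rescalings cost at most the factor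
    \<open>1 + \<epsilon>\<close>.\<close>
  define \<eta> where "\<eta> = \<epsilon> / (2 * (1 + \<epsilon>))"
  have eta: "0 < \<eta>" "\<eta> < 1 / 2"
    using \<open>\<epsilon> > 0\<close> by (simp_all add: \<eta>_def field_simps)
  have gap: "1 / (1 - \<eta>) * (1 / (1 - \<eta>)) \<le> 1 + \<epsilon>"
  proof -
    have "(1 - \<eta>) * (1 - \<eta>) = 1 - 2 * \<eta> + \<eta>\<^sup>2"
      by (simp add: power2_eq_square algebra_simps)
    then have "1 - 2 * \<eta> \<le> (1 - \<eta>) * (1 - \<eta>)"
      by simp
    moreover have "(1 + \<epsilon>) * (1 - 2 * \<eta>) = 1"
      using \<open>\<epsilon> > 0\<close> by (simp add: \<eta>_def field_simps)
    ultimately have "1 \<le> (1 + \<epsilon>) * ((1 - \<eta>) * (1 - \<eta>))"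
      using \<open>\<epsilon> > 0\<close> by (smt (verit) mult_left_mono)
    then have "1 / ((1 - \<eta>) * (1 - \<eta>)) \<le> 1 + \<epsilon>"
      using eta by (simp add: pos_divide_le_eq)
    then show ?thesis
      by simp
  qed
  obtain \<delta> where \<delta>: "\<delta> > 0" and pert:
    "\<forall>A' B' P K v. norm (A' - A) \<le> \<delta> \<and> norm (B' - B) \<le> \<delta> \<and> norm P \<le> C \<and> norm K \<le> C \<longrightarrow>
      \<bar>(v v* (A' + B' ** K)) \<bullet> (P *v (v v* (A' + B' ** K)))
        - (v v* (A + B ** K)) \<bullet> (P *v (v v* (A + B ** K)))\<bar> \<le> \<eta> * (v \<bullet> v)"
    by (rule closed_loop_perturbation[OF eta(1)])
  show thesis
  proof (rule that[OF \<delta>], intro allI impI, elim conjE)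
    fix A' B' assume close: "norm (A' - A) \<le> \<delta>" "norm (B' - B) \<le> \<delta>"
    have "norm Ps \<le> C" "norm Ks \<le> C"
      using bound[OF sub, of Ks] J unfolding J_def by linarith+
    then have sub': "subgramian (A' + B' ** Ks) ((1 / (1 - \<eta>)) *\<^sub>R Ps)"
      using eta close pert by (intro subgramian_rescale[OF sub]) auto
    have "\<exists>P K. lqr_optimal A' B' Q R (P, K)"
      by (rule ex_lqr_optimal[OF Q R sub']) blast
    moreover have "Schur (A + B ** K) \<and>
        ((H2_norm A B Q R K)\<^sup>2 - (H2_norm A B Q R (optimal_gain A B Q R))\<^sup>2)
          / (H2_norm A B Q R (optimal_gain A B Q R))\<^sup>2 \<le> \<epsilon>"
      if opt': "lqr_optimal A' B' Q R (P, K)" for P K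
    proof -
      have subP: "subgramian (A' + B' ** K) P"
        and "lqr_cost Q R P K \<le> lqr_cost Q R ((1 / (1 - \<eta>)) *\<^sub>R Ps) Ks"
        using opt' sub' unfolding lqr_optimal_iff by blast+
      then have cost: "lqr_cost Q R P K \<le> 1 / (1 - \<eta>) * J"
        by (simp only: lqr_cost_scaleR J_def)
      also have "\<dots> \<le> 2 * J"
        using eta J by (intro mult_right_mono) (auto simp: field_simps)
      finally have "norm P \<le> C" "norm K \<le> C"
        using bound[OF subP] by auto
      \<comment> \<open>The way back: the two-sided perturbation bound applies with the roles of the
        systems exchanged, now at the optimum of the estimated one.\<close>
      then have "\<bar>(v v* (A + B ** K)) \<bullet> (P *v (v v* (A + B ** K)))
          - (v v* (A' + B' ** K)) \<bullet> (P *v (v v* (A' + B' ** K)))\<bar> \<le> \<eta> * (v \<bullet> v)" for v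
        using pert close by (subst abs_minus_commute) blast
      then have subK: "subgramian (A + B ** K) ((1 / (1 - \<eta>)) *\<^sub>R P)"
        using eta by (intro subgramian_rescale[OF subP]) auto
      then have K: "Schur (A + B ** K)"
        by (rule subgramian_imp_Schur)
      have "(H2_norm A B Q R K)\<^sup>2 \<le> 1 / (1 - \<eta>) * lqr_cost Q R P K"
        using lqr_cost_gramian_le[OF Q R subK] H2_norm_squared[OF Q R K]
        by (simp only: lqr_cost_scaleR)
      also have "\<dots> \<le> 1 / (1 - \<eta>) * (1 / (1 - \<eta>) * J)"
        using cost eta by (intro mult_left_mono) auto
      also have "\<dots> \<le> (1 + \<epsilon>) * J"
        using mult_right_mono[OF gap, of J] J by (simp only: mult.assoc)
      finally have "(H2_norm A B Q R K)\<^sup>2 - J \<le> \<epsilon> * J"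
        by (simp add: algebra_simps)
      then show ?thesis
        using K J unfolding H2_norm_optimal_gain[OF Q R opt] J_def[symmetric]
        by (simp add: field_simps)
    qed
    ultimately show "(\<exists>P K. lqr_optimal A' B' Q R (P, K)) \<and>
      (\<forall>P K. lqr_optimal A' B' Q R (P, K) \<longrightarrow> Schur (A + B ** K) \<and>
        ((H2_norm A B Q R K)\<^sup>2 - (H2_norm A B Q R (optimal_gain A B Q R))\<^sup>2)
          / (H2_norm A B Q R (optimal_gain A B Q R))\<^sup>2 \<le> \<epsilon>)"
      by blast
  qed
qed

section \<open>Least squares\<close>


lemma transpose_gram: "transpose (gram T M) = gram T M"
  by (simp add: gram_def transpose_def vec_eq_iff mult.commute)

lemma inner_gram: "v \<bullet> (gram T M *v w) = (\<Sum>k<T. (M k \<bullet> v) * (M k \<bullet> w))"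
proof -
  have "gram T M *v w = (\<Sum>k<T. (M k \<bullet> w) *\<^sub>R M k)"
  proof (subst vec_eq_iff, rule allI)
    fix i
    have "(gram T M *v w) $ i = (\<Sum>j\<in>UNIV. \<Sum>k<T. M k $ i * M k $ j * w $ j)"
      by (simp add: gram_def matrix_vector_mult_def sum_distrib_right)
    also have "\<dots> = (\<Sum>k<T. \<Sum>j\<in>UNIV. M k $ i * M k $ j * w $ j)"
      by (rule sum.swap)
    also have "\<dots> = (\<Sum>k<T. (M k \<bullet> w) *\<^sub>R M k) $ i"
      by (simp add: inner_vec_def sum_distrib_left sum_distrib_right mult_ac)
    finally show "(gram T M *v w) $ i = (\<Sum>k<T. (M k \<bullet> w) *\<^sub>R M k) $ i" .
  qed
  then show ?thesis
    by (simp add: inner_sum_right inner_commute mult.commute)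
qed

lemma pos_semidef_gram: "pos_semidef (gram T M)"
  by (simp add: pos_semidef_def transpose_gram inner_gram sum_nonneg)

text \<open>Eigenvectors for distinct eigenvalues are orthogonal, hence finitely many. Without
  finiteness, \<open>Min\<close> and \<open>Max\<close> of the singular values would say
  nothing.\<close>

lemma finite_eigenvalues_symmetric:
  fixes G :: "real^'n^'n"
  assumes G: "transpose G = G"
  shows "finite {l. \<exists>v. v \<noteq> 0 \<and> G *v v = l *s v}"
proof -
  define E where "E = {l. \<exists>v. v \<noteq> 0 \<and> G *v v = l *s v}"
  have "\<forall>l\<in>E. \<exists>v. v \<noteq> 0 \<and> G *v v = l *s v"
    by (simp add: E_def)
  from bchoice[OF this] obtain f where f: "\<forall>l\<in>E. f l \<noteq> 0 \<and> G *v f l = l *s f l"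
    by blast
  have orth: "f k \<bullet> f l = 0" if "k \<in> E" "l \<in> E" "k \<noteq> l" for k l
  proof -
    have "f k \<bullet> (G *v f l) = f l \<bullet> (G *v f k)"
      by (metis G dot_lmul_matrix inner_commute vector_transpose_matrix)
    then have "l * (f k \<bullet> f l) = k * (f k \<bullet> f l)"
      using f that by (simp add: scalar_mult_eq_scaleR inner_commute)
    then show ?thesis
      using that by simp
  qed
  have "inj_on f E"
  proof (rule inj_onI, rule ccontr)
    fix k l assume kl: "k \<in> E" "l \<in> E" "f k = f l" "k \<noteq> l"
    have "f k \<bullet> f k = 0"
      using orth[OF kl(1,2,4)] kl(3) by simp
    then show False
      using f kl(1) by simp
  qed
  moreover have "pairwise orthogonal (f ` E)"
    using orth unfolding pairwise_def orthogonal_def by blast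
  then have "finite (f ` E)"
    by (rule pairwise_orthogonal_imp_finite)
  ultimately show ?thesis
    unfolding E_def by (rule finite_imageD[rotated])
qed

lemma finite_singular_values: "finite (singular_values T M)"
proof -
  have "singular_values T M = sqrt ` {l. \<exists>v. v \<noteq> 0 \<and> gram T M *v v = l *s v}"
    by (auto simp: singular_values_def)
  then show ?thesis
    by (simp add: finite_eigenvalues_symmetric transpose_gram)
qed

lemma eigenvalue_gram_nonneg:
  assumes "v \<noteq> 0" "gram T M *v v = l *s v"
  shows "0 \<le> l"
proof -
  have "0 \<le> v \<bullet> (gram T M *v v)"
    using pos_semidef_gram unfolding pos_semidef_def by blast
  also have "\<dots> = l * (v \<bullet> v)"
    by (simp add: assms(2) scalar_mult_eq_scaleR)
  finally show ?thesis
    using assms(1) inner_ge_zero[of v] by (auto simp: zero_le_mult_iff)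
qed

text \<open>The minimum of the Rayleigh quotient is an eigenvalue, so its root belongs to the set
  whose \<open>Min\<close> is taken. Nonnegative eigenvalues permit squaring.\<close>

lemma sigma_min_le:
  shows "0 \<le> sigma_min T M" "(sigma_min T M)\<^sup>2 * (v \<bullet> v) \<le> (\<Sum>k<T. (M k \<bullet> v)\<^sup>2)"
proof -
  obtain l w where w: "w \<noteq> 0" "gram T M *v w = l *s w"
    and l: "\<forall>v. l * (v \<bullet> v) \<le> v \<bullet> (gram T M *v v)"
    by (rule symmetric_min_eigenvalue[OF transpose_gram])
  have mem: "sqrt l \<in> singular_values T M"
    using w by (auto simp: singular_values_def)
  have "s \<ge> 0" if "s \<in> singular_values T M" for s
    using that eigenvalue_gram_nonneg by (auto simp: singular_values_def)
  then show pos: "0 \<le> sigma_min T M"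
    using mem finite_singular_values[of T M] unfolding sigma_min_def
    by (intro Min.boundedI) auto
  have "sigma_min T M \<le> sqrt l"
    unfolding sigma_min_def by (intro Min_le finite_singular_values mem)
  then have "(sigma_min T M)\<^sup>2 \<le> (sqrt l)\<^sup>2"
    using pos by (intro power_mono)
  also have "\<dots> = l"
    using eigenvalue_gram_nonneg[OF w] by simp
  finally have "(sigma_min T M)\<^sup>2 * (v \<bullet> v) \<le> l * (v \<bullet> v)"
    by (intro mult_right_mono) auto
  also have "\<dots> \<le> (\<Sum>k<T. (M k \<bullet> v)\<^sup>2)"
    using l[rule_format, of v] by (simp add: inner_gram power2_eq_square)
  finally show "(sigma_min T M)\<^sup>2 * (v \<bullet> v) \<le> (\<Sum>k<T. (M k \<bullet> v)\<^sup>2)" .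
qed

lemma sigma_max_ge:
  shows "0 \<le> sigma_max T M" "(\<Sum>k<T. (M k \<bullet> v)\<^sup>2) \<le> (sigma_max T M)\<^sup>2 * (v \<bullet> v)"
proof -
  \<comment> \<open>The largest eigenvalue is minus the smallest one of the negated Gram
    matrix.\<close>
  have "transpose (- gram T M) = - gram T M"
    using transpose_gram[of T M] by (simp add: transpose_def vec_eq_iff)
  then obtain l w where w: "w \<noteq> 0" "- gram T M *v w = l *s w"
    and l: "\<forall>v. l * (v \<bullet> v) \<le> v \<bullet> (- gram T M *v v)"
    by (rule symmetric_min_eigenvalue)
  have neg: "- gram T M *v v = - (gram T M *v v)" for v
    using matrix_vector_mult_diff_rdistrib[of 0 "gram T M" v] by simp
  have w': "gram T M *v w = (- l) *s w"
    using w(2) unfolding neg by (simp add: scalar_mult_eq_scaleR minus_equation_iff)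
  have mem: "sqrt (- l) \<in> singular_values T M"
    using w(1) w' by (auto simp: singular_values_def)
  have l0: "0 \<le> - l"
    by (rule eigenvalue_gram_nonneg[OF w(1) w'])
  have le: "sqrt (- l) \<le> sigma_max T M"
    unfolding sigma_max_def by (intro Max_ge finite_singular_values mem)
  then show "0 \<le> sigma_max T M"
    using l0 by (meson order_trans real_sqrt_ge_zero)
  have "(\<Sum>k<T. (M k \<bullet> v)\<^sup>2) \<le> - l * (v \<bullet> v)"
    using l[rule_format, of v] by (simp add: neg inner_gram power2_eq_square)
  also have "- l = (sqrt (- l))\<^sup>2"
    using l0 by simp
  also have "(sqrt (- l))\<^sup>2 * (v \<bullet> v) \<le> (sigma_max T M)\<^sup>2 * (v \<bullet> v)"
    using le l0 by (intro mult_right_mono power_mono) auto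
  finally show "(\<Sum>k<T. (M k \<bullet> v)\<^sup>2) \<le> (sigma_max T M)\<^sup>2 * (v \<bullet> v)" .
qed

section \<open>Frobenius norms of data sequences\<close>

lemma frobenius_squared: "(frobenius T M)\<^sup>2 = (\<Sum>k<T. (norm (M k))\<^sup>2)"
  unfolding frobenius_def power2_norm_eq_inner inner_vec_def
  by (simp add: sum_nonneg power2_eq_square)

lemma frobenius_nonneg: "0 \<le> frobenius T M"
  by (simp add: frobenius_def sum_nonneg)

lemma frobenius_eq_L2_set: "frobenius T M = L2_set (\<lambda>k. norm (M k)) {..<T}"
  unfolding L2_set_def frobenius_squared[symmetric] using frobenius_nonneg[of T M] by simp

lemma frobenius_diff_le: "frobenius T (\<lambda>k. M k - N k) \<le> frobenius T M + frobenius T N"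
proof -
  have "frobenius T (\<lambda>k. M k - N k) \<le> L2_set (\<lambda>k. norm (M k) + norm (N k)) {..<T}"
    unfolding frobenius_eq_L2_set by (intro L2_set_mono norm_triangle_ineq4) auto
  also have "\<dots> \<le> frobenius T M + frobenius T N"
    unfolding frobenius_eq_L2_set by (rule L2_set_triangle_ineq)
  finally show ?thesis .
qed

lemma sum_norm_matrix_vector_squared:
  fixes X :: "real^'r^'n"
  shows "(\<Sum>k<T. (norm (X *v M k))\<^sup>2) = (\<Sum>i\<in>UNIV. \<Sum>k<T. (M k \<bullet> X $ i)\<^sup>2)"
proof -
  have "(norm (X *v w))\<^sup>2 = (\<Sum>i\<in>UNIV. (w \<bullet> X $ i)\<^sup>2)" for w
    unfolding power2_norm_eq_inner inner_vec_def[of "X *v w"]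
    by (simp add: matrix_vector_mul_component power2_eq_square inner_commute)
  then show ?thesis
    by (simp add: sum.swap[of _ UNIV])
qed

text \<open>The singular value bound is applied to each row of \<open>X\<close> and summed. It turns
  a small fit difference on the data into a small parameter error.\<close>

lemma sigma_min_norm_le_frobenius:
  fixes X :: "real^'r^'n"
  shows "sigma_min T M * norm X \<le> frobenius T (\<lambda>k. X *v M k)"
proof (rule power2_le_imp_le[OF _ frobenius_nonneg])
  have "(sigma_min T M * norm X)\<^sup>2 = (\<Sum>i\<in>UNIV. (sigma_min T M)\<^sup>2 * (X $ i \<bullet> X $ i))"
    unfolding power_mult_distrib power2_norm_eq_inner inner_vec_def[of X] by (simp add: sum_distrib_left)
  also have "\<dots> \<le> (\<Sum>i\<in>UNIV. \<Sum>k<T. (M k \<bullet> X $ i)\<^sup>2)"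
    by (intro sum_mono sigma_min_le)
  finally show "(sigma_min T M * norm X)\<^sup>2 \<le> (frobenius T (\<lambda>k. X *v M k))\<^sup>2"
    by (simp add: frobenius_squared sum_norm_matrix_vector_squared)
qed

text \<open>The rows of the identity pick out the coordinates of the data, and each contributes at
  most the squared singular value. This is where the square root of the dimension in \<nu>
  originates.\<close>

lemma frobenius_le_sigma_max:
  fixes M :: "nat \<Rightarrow> real^'n"
  shows "frobenius T M \<le> sqrt (real CARD('n)) * sigma_max T M"
proof (rule power2_le_imp_le)
  have "(frobenius T M)\<^sup>2 = (\<Sum>i\<in>UNIV. \<Sum>k<T. (M k \<bullet> (mat 1 :: real^'n^'n) $ i)\<^sup>2)"
    unfolding frobenius_squared sum_norm_matrix_vector_squared[symmetric] by simp
  also have "\<dots> \<le> (\<Sum>i\<in>(UNIV::'n set). (sigma_max T M)\<^sup>2 * ((mat 1 :: real^'n^'n) $ i \<bullet> (mat 1 :: real^'n^'n) $ i))"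
    by (intro sum_mono sigma_max_ge)
  also have "\<dots> = (\<Sum>i\<in>(UNIV::'n set). (sigma_max T M)\<^sup>2)"
  proof -
    have "(mat 1 :: real^'n^'n) $ i = axis i 1" for i
      by (auto simp: vec_eq_iff mat_def axis_def)
    then show ?thesis
      by (simp add: inner_axis_axis)
  qed
  finally show "(frobenius T M)\<^sup>2 \<le> (sqrt (real CARD('n)) * sigma_max T M)\<^sup>2"
    by (simp add: power_mult_distrib)
qed (simp add: sigma_max_ge)

section \<open>Block rows and the estimate\<close>

lemma block_row_mult: "block_row B A *v W0 u x k = B *v u k + A *v x k"
proof (subst vec_eq_iff, rule allI)
  fix i
  have "(block_row B A *v W0 u x k) $ i = (\<Sum>j\<in>UNIV. block_row B A $ i $ j * W0 u x k $ j)"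
    by (simp add: matrix_vector_mult_def)
  also have "\<dots> = (\<Sum>j\<in>UNIV <+> UNIV. block_row B A $ i $ j * W0 u x k $ j)"
    by simp
  also have "\<dots> = (B *v u k + A *v x k) $ i"
    by (subst sum.Plus) (simp_all add: block_row_def W0_def matrix_vector_mult_def)
  finally show "(block_row B A *v W0 u x k) $ i = (B *v u k + A *v x k) $ i" .
qed

lemma block_row_diff: "block_row B A - block_row B' A' = block_row (B - B') (A - A')"
  by (auto simp: vec_eq_iff block_row_def split: sum.split)

lemma norm_block_row_squared:
  "(norm (block_row B A))\<^sup>2 = (norm B)\<^sup>2 + (norm A)\<^sup>2"
proof -
  have "(\<Sum>j\<in>UNIV. block_row B A $ i $ j * block_row B A $ i $ j)
      = (\<Sum>j\<in>UNIV. B $ i $ j * B $ i $ j) + (\<Sum>j\<in>UNIV. A $ i $ j * A $ i $ j)" for i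
  proof -
    have "(\<Sum>j\<in>UNIV. block_row B A $ i $ j * block_row B A $ i $ j)
        = (\<Sum>j\<in>UNIV <+> UNIV. block_row B A $ i $ j * block_row B A $ i $ j)"
      by simp
    also have "\<dots> = (\<Sum>j\<in>UNIV. B $ i $ j * B $ i $ j) + (\<Sum>j\<in>UNIV. A $ i $ j * A $ i $ j)"
      by (subst sum.Plus) (simp_all add: block_row_def)
    finally show ?thesis .
  qed
  then show ?thesis
    unfolding power2_norm_eq_inner by (simp add: inner_vec_def sum.distrib)
qed

lemma norm_le_norm_block_row:
  "norm B \<le> norm (block_row B A)" "norm A \<le> norm (block_row B A)"
  by (rule power2_le_imp_le; simp add: norm_block_row_squared)+

lemma continuous_on_block_row [continuous_intros]:
  assumes "continuous_on S f" "continuous_on S g"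
  shows "continuous_on S (\<lambda>x. block_row (f x) (g x))"
  unfolding block_row_def
proof (intro continuous_on_vec_lambda)
  fix i j
  show "continuous_on S (\<lambda>x. case j of Inl a \<Rightarrow> f x $ i $ a | Inr b \<Rightarrow> g x $ i $ b)"
    by (cases j) (auto intro!: continuous_intros assms)
qed

text \<open>Positivity of the smallest singular value makes the residual coercive, so its sublevel
  set at the residual of the zero matrices is compact.\<close>

lemma ex_least_squares:
  fixes x :: "nat \<Rightarrow> real^'n" and u :: "nat \<Rightarrow> real^'m"
  assumes pos: "sigma_min T (W0 u x) > 0"
  shows "\<exists>\<theta>. is_arg_min (\<lambda>(B, A). frobenius T (\<lambda>k. x (k + 1) - block_row B A *v W0 u x k)) (\<lambda>_. True) \<theta>"
proof -
  define W where "W = W0 u x"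
  define f where "f = (\<lambda>\<theta> :: (real^'m^'n) \<times> (real^'n^'n).
    frobenius T (\<lambda>k. x (k + 1) - block_row (fst \<theta>) (snd \<theta>) *v W k))"
  define S where "S = {\<theta>. f \<theta> \<le> f 0}"
  \<comment> \<open>By the triangle inequality the fitted data have norm at most the residual at 0
    plus that at \<theta>, hence at most \<open>2 * f 0\<close> on the sublevel set.\<close>
  define C where "C = 2 * f 0 / sigma_min T W"
  have f0: "f 0 = frobenius T (\<lambda>k. x (k + 1))"
  proof -
    have "block_row (0 :: real^'m^'n) (0 :: real^'n^'n) = 0"
      by (auto simp: vec_eq_iff block_row_def split: sum.split)
    then show ?thesis
      by (simp add: f_def)
  qed
  have cont: "continuous_on S f" for S
    unfolding f_def frobenius_def by (intro continuous_intros)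
  have "bounded S"
  proof (rule bounded_subset)
    show "bounded (cball 0 C \<times> cball 0 C :: ((real^'m^'n) \<times> (real^'n^'n)) set)"
      by (intro bounded_Times bounded_cball)
    show "S \<subseteq> cball 0 C \<times> cball 0 C"
    proof
      fix \<theta> assume "\<theta> \<in> S"
      then have le: "f \<theta> \<le> f 0"
        by (simp add: S_def)
      define X where "X = block_row (fst \<theta>) (snd \<theta>)"
      have "sigma_min T W * norm X \<le> frobenius T (\<lambda>k. X *v W k)"
        by (rule sigma_min_norm_le_frobenius)
      also have "\<dots> = frobenius T (\<lambda>k. x (k + 1) - (x (k + 1) - X *v W k))"
        by simp
      also have "\<dots> \<le> f 0 + f \<theta>"
        unfolding f0 by (simp only: f_def X_def frobenius_diff_le)
      finally have "norm X \<le> C"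
        using le pos by (simp add: C_def W_def field_simps)
      then show "\<theta> \<in> cball 0 C \<times> cball 0 C"
        using norm_le_norm_block_row[where B = "fst \<theta>" and A = "snd \<theta>"] by (auto simp: mem_Times_iff X_def)
    qed
  qed
  moreover have "closed S"
    unfolding S_def by (intro closed_Collect_le cont continuous_on_const)
  ultimately have "compact S"
    by (simp add: compact_eq_bounded_closed)
  moreover have "S \<noteq> {}"
    unfolding S_def by blast
  ultimately have "\<exists>\<theta>\<in>S. \<forall>\<phi>\<in>S. f \<theta> \<le> f \<phi>"
    using cont by (rule continuous_attains_inf)
  then obtain \<theta> where th: "\<theta> \<in> S" "\<forall>\<phi>\<in>S. f \<theta> \<le> f \<phi>"
    by blast
  have "f \<theta> \<le> f \<phi>" for \<phi>
  proof (cases "f \<phi> \<le> f 0")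
    case True
    then show ?thesis
      using th(2) unfolding S_def by blast
  next
    case False
    moreover have "f \<theta> \<le> f 0"
      using th(1) unfolding S_def by blast
    ultimately show ?thesis
      by linarith
  qed
  then have "is_arg_min f (\<lambda>_. True) \<theta>"
    by (simp add: is_arg_min_linorder)
  then show ?thesis
    unfolding f_def W_def case_prod_beta by blast
qed

text \<open>The residual of the estimate is at most that of the true matrices, which is the
  disturbance; hence the two fits differ by at most twice the disturbance on the data.\<close>

lemma ls_estimate_error:
  fixes A :: "real^'n^'n" and B :: "real^'m^'n"
  assumes traj: "trajectory A B T u x d" and pos: "sigma_min T (W0 u x) > 0"
    and est: "ls_estimate T u x = (Bh, Ah)"
  shows "sigma_min T (W0 u x) * norm (block_row (Bh - B) (Ah - A))
    \<le> 2 * sqrt (real CARD('n)) * sigma_max T d"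
proof -
  define f where "f = (\<lambda>(B, A). frobenius T (\<lambda>k. x (k + 1) - block_row B A *v W0 u x k))"
  \<comment> \<open>\<open>arg_min\<close> is a choice; it yields a minimiser because one
    exists.\<close>
  have "is_arg_min f (\<lambda>_. True) (ls_estimate T u x)"
    unfolding ls_estimate_def f_def[symmetric] arg_min_def
    by (rule someI_ex) (use ex_least_squares[OF pos] f_def in simp)
  then have le: "f (Bh, Ah) \<le> f (B, A)"
    unfolding est by (simp only: is_arg_min_linorder)
  have d: "f (B, A) = frobenius T d"
  proof -
    have "x (k + 1) - block_row B A *v W0 u x k = d k" if "k < T" for k
      using traj that by (simp add: trajectory_def block_row_mult)
    then show ?thesis
      unfolding f_def prod.case frobenius_eq_L2_set by (intro L2_set_cong) auto
  qed
  have "sigma_min T (W0 u x) * norm (block_row (Bh - B) (Ah - A))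
      \<le> frobenius T (\<lambda>k. block_row (Bh - B) (Ah - A) *v W0 u x k)"
    by (rule sigma_min_norm_le_frobenius)
  also have "\<dots> = frobenius T (\<lambda>k. (x (k + 1) - block_row B A *v W0 u x k)
      - (x (k + 1) - block_row Bh Ah *v W0 u x k))"
    by (simp add: block_row_diff[symmetric] matrix_vector_mult_diff_rdistrib)
  also have "\<dots> \<le> f (B, A) + f (Bh, Ah)"
    unfolding f_def prod.case by (rule frobenius_diff_le)
  also have "\<dots> \<le> 2 * frobenius T d"
    using le d by simp
  also have "\<dots> \<le> 2 * (sqrt (real CARD('n)) * sigma_max T d)"
    using frobenius_le_sigma_max[of T d] by simp
  finally show ?thesis
    by simp
qed

text \<open>The product form of the bound also covers vanishing disturbance, where the ratio is
  infinite.\<close>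

lemma SNR_greater_imp:
  assumes "SNR T u x d > ereal \<nu>" "\<nu> > 0"
  shows "sigma_min T (W0 u x) > 0" "\<nu> * sigma_max T d \<le> sigma_min T (W0 u x)"
proof -
  have min: "0 \<le> sigma_min T (W0 u x)" and max: "0 \<le> sigma_max T d"
    by (rule sigma_min_le sigma_max_ge)+
  show pos: "sigma_min T (W0 u x) > 0"
  proof (rule ccontr)
    assume "\<not> sigma_min T (W0 u x) > 0"
    \<comment> \<open>In the extended reals 0 divided by 0 is 0, so this holds even without
      disturbance.\<close>
    then have "SNR T u x d = 0"
      using min by (simp add: SNR_def flip: zero_ereal_def)
    then show False
      using assms by simp
  qed
  show "\<nu> * sigma_max T d \<le> sigma_min T (W0 u x)"
  proof (cases "sigma_max T d = 0")
    case False
    then have "SNR T u x d = ereal (sigma_min T (W0 u x) / sigma_max T d)"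
      by (simp add: SNR_def)
    then show ?thesis
      using assms(1) False max by (simp add: field_simps)
  qed (use pos in simp)
qed

theorem mainTheorem4:
  fixes A :: "real^'n^'n" and B :: "real^'m^'n"
    and Q :: "real^'n^'n" and R :: "real^'m^'m"
  assumes "stabilizable A B" and "pos_def Q" and "pos_def R"
  shows "\<forall>\<epsilon>>0. \<exists>\<nu>>0. \<forall>(T::nat) (u :: nat \<Rightarrow> real^'m) (x :: nat \<Rightarrow> real^'n) (d :: nat \<Rightarrow> real^'n).
    trajectory A B T u x d \<and> data_rank T (W0 u x) = CARD('n) + CARD('m) \<and> SNR T u x d > ereal \<nu> \<longrightarrow>
      (\<exists>P K. ce_feasible T u x (P, K)) \<and>
      (\<exists>P K. ce_optimal Q R T u x (P, K)) \<and>
      (\<forall>P K. ce_optimal Q R T u x (P, K) \<longrightarrow>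
        Schur (A + B ** K) \<and>
        ((H2_norm A B Q R K)\<^sup>2 - (H2_norm A B Q R (optimal_gain A B Q R))\<^sup>2)
          / (H2_norm A B Q R (optimal_gain A B Q R))\<^sup>2 \<le> \<epsilon>)"
proof (intro allI impI)
  fix \<epsilon> :: real assume "\<epsilon> > 0"
  obtain \<delta> where \<delta>: "\<delta> > 0" and CE:
    "\<forall>A' B'. norm (A' - A) \<le> \<delta> \<and> norm (B' - B) \<le> \<delta> \<longrightarrow>
      (\<exists>P K. lqr_optimal A' B' Q R (P, K)) \<and>
      (\<forall>P K. lqr_optimal A' B' Q R (P, K) \<longrightarrow> Schur (A + B ** K) \<and>
        ((H2_norm A B Q R K)\<^sup>2 - (H2_norm A B Q R (optimal_gain A B Q R))\<^sup>2)
          / (H2_norm A B Q R (optimal_gain A B Q R))\<^sup>2 \<le> \<epsilon>)"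
    by (rule certainty_equivalence_suboptimality[OF assms \<open>\<epsilon> > 0\<close>])
  \<comment> \<open>Solves \<open>2 * sqrt n / \<nu> = \<delta>\<close>, with \<open>n\<close> the
    state dimension: the estimation error is at most \<open>2 * sqrt n\<close> times the
    noise-to-signal ratio.\<close>
  define \<nu> where "\<nu> = 2 * sqrt (real CARD('n)) / \<delta>"
  have \<nu>: "\<nu> > 0"
    using \<delta> by (simp add: \<nu>_def)
  have "(\<exists>P K. ce_feasible T u x (P, K)) \<and>
      (\<exists>P K. ce_optimal Q R T u x (P, K)) \<and>
      (\<forall>P K. ce_optimal Q R T u x (P, K) \<longrightarrow>
        Schur (A + B ** K) \<and>
        ((H2_norm A B Q R K)\<^sup>2 - (H2_norm A B Q R (optimal_gain A B Q R))\<^sup>2)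
          / (H2_norm A B Q R (optimal_gain A B Q R))\<^sup>2 \<le> \<epsilon>)"
    if traj: "trajectory A B T u x d" and snr: "SNR T u x d > ereal \<nu>"
    for T and u :: "nat \<Rightarrow> real^'m" and x d :: "nat \<Rightarrow> real^'n"
  proof -
    define s where "s = sigma_min T (W0 u x)"
    have s: "s > 0" and snr': "\<nu> * sigma_max T d \<le> s"
      using SNR_greater_imp[OF snr \<nu>] by (simp_all add: s_def)
    obtain Bh Ah where est: "ls_estimate T u x = (Bh, Ah)"
      by fastforce
    have "s * norm (block_row (Bh - B) (Ah - A)) \<le> \<delta> * (\<nu> * sigma_max T d)"
      using ls_estimate_error[OF traj s[unfolded s_def] est] \<delta> by (simp add: \<nu>_def s_def)
    also have "\<dots> \<le> \<delta> * s"
      using snr' \<delta> by simp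
    finally have "norm (block_row (Bh - B) (Ah - A)) \<le> \<delta>"
      using s by (simp add: mult.commute)
    then have "norm (Ah - A) \<le> \<delta>" "norm (Bh - B) \<le> \<delta>"
      using norm_le_norm_block_row[where B = "Bh - B" and A = "Ah - A"] by linarith+
    then have CE': "(\<exists>P K. lqr_optimal Ah Bh Q R (P, K)) \<and>
      (\<forall>P K. lqr_optimal Ah Bh Q R (P, K) \<longrightarrow> Schur (A + B ** K) \<and>
        ((H2_norm A B Q R K)\<^sup>2 - (H2_norm A B Q R (optimal_gain A B Q R))\<^sup>2)
          / (H2_norm A B Q R (optimal_gain A B Q R))\<^sup>2 \<le> \<epsilon>)"
      using CE by blast
    \<comment> \<open>For the estimated matrices the constraints of (I) are exactly the subgramian
      condition, so both optimality predicates coincide and the robustness result applies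
      verbatim.\<close>
    have feas: "ce_feasible T u x = (\<lambda>(P, K). subgramian (Ah + Bh ** K) P)"
      by (simp add: ce_feasible_def est subgramian_iff_loewner)
    then have opt: "ce_optimal Q R T u x = lqr_optimal Ah Bh Q R"
      by (simp add: ce_optimal_def)
    have "\<exists>P K. ce_feasible T u x (P, K)"
      using CE' unfolding feas lqr_optimal_iff by blast
    then show ?thesis
      unfolding opt using CE' by blast
  qed
  with \<nu> show "\<exists>\<nu>>0. \<forall>(T::nat) (u :: nat \<Rightarrow> real^'m) (x :: nat \<Rightarrow> real^'n) (d :: nat \<Rightarrow> real^'n).
    trajectory A B T u x d \<and> data_rank T (W0 u x) = CARD('n) + CARD('m) \<and> SNR T u x d > ereal \<nu> \<longrightarrow>
      (\<exists>P K. ce_feasible T u x (P, K)) \<and>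
      (\<exists>P K. ce_optimal Q R T u x (P, K)) \<and>
      (\<forall>P K. ce_optimal Q R T u x (P, K) \<longrightarrow>
        Schur (A + B ** K) \<and>
        ((H2_norm A B Q R K)\<^sup>2 - (H2_norm A B Q R (optimal_gain A B Q R))\<^sup>2)
          / (H2_norm A B Q R (optimal_gain A B Q R))\<^sup>2 \<le> \<epsilon>)"
    by blast
qed

end
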